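(* There is a polynomial-time algorithm that, given $k\in\mathbb{N}$, an OVPP $k$-grabbing pawn game $\mathcal{G}$ and an initial configuration, decides whether Player 1 wins from that configuration in $\mathcal{G}$.
   Context: A pawn game with $d$ pawns consists of a finite directed graph $(V,E)$, a target set $T\subseteq V$, and sets $V_1,\dots,V_d\subseteq V$ covering $V$, where Pawn $j$ owns $V_j$. In an OVPP (one vertex per pawn) game, $|V|=d$ and each $V_j$ is a singleton. Player 1 moves the token from $v$ (along an edge) iff he controls a pawn owning $v$; otherwise Player 2 moves. In the $k$-grabbing mechanism, configurations are $\langle v,P,r\rangle$ with $v$ the token position, $P\subseteq[d]$ the pawns controlled by Player 1, and $r\in\{0,\dots,k\}$ the number of remaining grabs; the initial configuration has $r=k$. After each move of the token (by either player), Player 1 may either do nothing or, if $r>0$, take a pawn $j\notin P$, moving to $P\cup\{j\}$ and $r-1$; grabbed pawns remain with Player 1 forever, and Player 2 never grabs. Player 1 wins a play iff it visits $T$; Player 1 wins from a configuration if he has a strategy winning against all Player 2 strategies. *)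

theory Defs
  imports Main
begin

text \<open>An OVPP game with d pawns: vertices 0..d-1, pawn j owns exactly vertex j
  (w.l.o.g. after renaming pawns), edge relation E, target set T.\<close>

record game =
  gd :: nat
  gE :: "(nat \<times> nat) set"
  gT :: "nat set"

definition wf_game :: "game \<Rightarrow> bool" where
  "wf_game G \<longleftrightarrow> gE G \<subseteq> {..<gd G} \<times> {..<gd G} \<and> gT G \<subseteq> {..<gd G}"

text \<open>Configuration (v, P, r): token position, pawns controlled by Player 1, grabs left.\<close>
type_synonym conf = "nat \<times> nat set \<times> nat"

definition valid_conf :: "game \<Rightarrow> nat \<Rightarrow> conf \<Rightarrow> bool" where
  "valid_conf G k c \<longleftrightarrow> (case c of (v, P, r) \<Rightarrow> v < gd G \<and> P \<subseteq> {..<gd G} \<and> r \<le> k)"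

definition has_succ :: "game \<Rightarrow> nat \<Rightarrow> bool" where
  "has_succ G v \<longleftrightarrow> (\<exists>w. (v, w) \<in> gE G)"

text \<open>Strategies act on histories (nonempty lists of configurations, last = current).
  Player 1: a token-moving function (used when he controls the pawn owning the
  current vertex) and a grabbing function (given the history and the new token
  position, optionally grab a pawn).  Player 2: a token-moving function.\<close>

definition legal_move_strat :: "game \<Rightarrow> (conf list \<Rightarrow> nat) \<Rightarrow> bool" where
  "legal_move_strat G m \<longleftrightarrow>
     (\<forall>h. h \<noteq> [] \<longrightarrow> has_succ G (fst (last h)) \<longrightarrow> (fst (last h), m h) \<in> gE G)"

definition legal_grab_strat :: "game \<Rightarrow> (conf list \<Rightarrow> nat \<Rightarrow> nat option) \<Rightarrow> bool" where
  "legal_grab_strat G g \<longleftrightarrow>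
     (\<forall>h u j. h \<noteq> [] \<longrightarrow> g h u = Some j \<longrightarrow>
        (case last h of (v, P, r) \<Rightarrow> j < gd G \<and> j \<notin> P \<and> 0 < r))"

definition next_hist ::
  "game \<Rightarrow> (conf list \<Rightarrow> nat) \<Rightarrow> (conf list \<Rightarrow> nat \<Rightarrow> nat option) \<Rightarrow> (conf list \<Rightarrow> nat)
   \<Rightarrow> conf list \<Rightarrow> conf list" where
  "next_hist G m1 g m2 h =
     (case last h of (v, P, r) \<Rightarrow>
        if \<not> has_succ G v then h
        else (let u = (if v \<in> P then m1 h else m2 h) in
              case g h u of
                None \<Rightarrow> h @ [(u, P, r)]
              | Some j \<Rightarrow> h @ [(u, insert j P, r - 1)]))"

definition play_prefix ::
  "game \<Rightarrow> (conf list \<Rightarrow> nat) \<Rightarrow> (conf list \<Rightarrow> nat \<Rightarrow> nat option) \<Rightarrow> (conf list \<Rightarrow> nat)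
   \<Rightarrow> conf \<Rightarrow> nat \<Rightarrow> conf list" where
  "play_prefix G m1 g m2 c0 n = (next_hist G m1 g m2 ^^ n) [c0]"

definition visits_target ::
  "game \<Rightarrow> (conf list \<Rightarrow> nat) \<Rightarrow> (conf list \<Rightarrow> nat \<Rightarrow> nat option) \<Rightarrow> (conf list \<Rightarrow> nat)
   \<Rightarrow> conf \<Rightarrow> bool" where
  "visits_target G m1 g m2 c0 \<longleftrightarrow>
     (\<exists>n. \<exists>c \<in> set (play_prefix G m1 g m2 c0 n). fst c \<in> gT G)"

text \<open>Player 1 wins from c0 in the k-grabbing game on G (k enters through the
  configuration, whose grab counter is at most k).\<close>
definition P1_wins :: "game \<Rightarrow> nat \<Rightarrow> conf \<Rightarrow> bool" where
  "P1_wins G k c0 \<longleftrightarrow>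
     (\<exists>m1 g. legal_move_strat G m1 \<and> legal_grab_strat G g \<and>
        (\<forall>m2. legal_move_strat G m2 \<longrightarrow> visits_target G m1 g m2 c0))"

fun bin :: "nat \<Rightarrow> bool list" where
  "bin n = (if n = 0 then [] else odd n # bin (n div 2))"

text \<open>Three-letter alphabet {0,1,#} coded by bit pairs.\<close>
definition enc_bits :: "bool list \<Rightarrow> bool list" where
  "enc_bits bs = concat (map (\<lambda>b. if b then [False, True] else [False, False]) bs)"

definition sep :: "bool list" where
  "sep = [True, False]"

definition enc_nat :: "nat \<Rightarrow> bool list" where
  "enc_nat n = enc_bits (bin n) @ sep"

definition enc_set :: "nat \<Rightarrow> nat set \<Rightarrow> bool list" where
  "enc_set d S = enc_bits (map (\<lambda>j. j \<in> S) [0..<d]) @ sep"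

definition enc_matrix :: "nat \<Rightarrow> (nat \<times> nat) set \<Rightarrow> bool list" where
  "enc_matrix d E = concat (map (\<lambda>i. enc_bits (map (\<lambda>j. (i, j) \<in> E) [0..<d]) @ sep) [0..<d])"

definition enc_instance :: "nat \<Rightarrow> game \<Rightarrow> conf \<Rightarrow> bool list" where
  "enc_instance k G c = (case c of (v, P, r) \<Rightarrow>
     enc_matrix (gd G) (gE G) @ enc_set (gd G) (gT G) @ enc_set (gd G) P
     @ enc_nat v @ enc_nat r @ enc_nat k)"

text \<open>States 0..nstates-1 (0 start, 1 accept, 2 reject); tape symbols
  0..nsyms-1 (0 blank, 1 = input bit False, 2 = input bit True);
  moves 0/1/2 = left/stay/right.\<close>
record tm =
  nstates :: nat
  nsyms :: nat
  delta :: "nat \<Rightarrow> nat \<Rightarrow> nat \<times> nat \<times> nat"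

definition wf_tm :: "tm \<Rightarrow> bool" where
  "wf_tm M \<longleftrightarrow> 3 \<le> nstates M \<and> 3 \<le> nsyms M \<and>
     (\<forall>q < nstates M. \<forall>s < nsyms M. case delta M q s of (q', s', mv) \<Rightarrow>
        q' < nstates M \<and> s' < nsyms M \<and> mv \<le> 2)"

type_synonym tm_conf = "nat \<times> (int \<Rightarrow> nat) \<times> int"

definition tm_step :: "tm \<Rightarrow> tm_conf \<Rightarrow> tm_conf" where
  "tm_step M c = (case c of (q, tp, pos) \<Rightarrow>
     if q = 1 \<or> q = 2 then (q, tp, pos)
     else (case delta M q (tp pos) of (q', s', mv) \<Rightarrow> (q', tp(pos := s'), pos + int mv - 1)))"

definition tm_init :: "bool list \<Rightarrow> tm_conf" where
  "tm_init w = (0, \<lambda>i. if 0 \<le> i \<and> i < int (length w) then (if w ! nat i then 2 else 1) else 0, 0)"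

end

theory Submission
  imports Defs
begin

text \<open>It never helps to grab a pawn other than the one of the vertex just reached, and paying again
  when a grabbed vertex is revisited does not change the number of grabs needed. So Player 1 wins
  with \<open>r\<close> grabs iff the initial vertex lies in one attractor step over the region \<open>grab_win r\<close>,
  obtained by \<open>r\<close> times alternating attractor closure and one predecessor step. The initial vertex
  itself cannot be grabbed before the first move, hence the separate last step. The alternation
  becomes stationary after at most \<open>d\<close> grabs, which keeps the time polynomial although \<open>r\<close> is given
  in binary.

  The Turing machine works in full sweeps over the input, so that each sweep is a finite transducer
  acting on a list. Every matrix entry \<open>(i, j)\<close> stores, besides the edge bit, whether \<open>j\<close> is already
  winning; then a single sweep evaluates the row of the examined vertex \<open>c\<close>. A pointer to column
  \<open>c\<close>, kept in all rows, allows the next sweep to write the result to column \<open>c\<close> everywhere and to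
  advance the pointer.\<close>

section \<open>Winning regions\<close>

text \<open>\<open>n\<close> bounds the number of grabs along a play when each of them takes the pawn of the vertex
  just reached. A vertex visited again after being grabbed is paid for again.\<close>
inductive grab_win :: "('a \<times> 'a) set \<Rightarrow> 'a set \<Rightarrow> 'a set \<Rightarrow> nat \<Rightarrow> 'a \<Rightarrow> bool"
  for E P B where
  base: "v \<in> B \<Longrightarrow> grab_win E P B n v"
| own: "v \<in> P \<Longrightarrow> (v, w) \<in> E \<Longrightarrow> grab_win E P B n w \<Longrightarrow> grab_win E P B n v"
| all: "(v, w) \<in> E \<Longrightarrow> (\<And>u. (v, u) \<in> E \<Longrightarrow> grab_win E P B n u) \<Longrightarrow> grab_win E P B n v"
| grab: "(v, w) \<in> E \<Longrightarrow> grab_win E P B n w \<Longrightarrow> grab_win E P B (Suc n) v"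

text \<open>One attractor step with base \<open>B\<close>. The last disjunct demands a successor in
  \<open>X\<close> because a dead end outside the base is lost.\<close>

definition attr :: "('a \<times> 'a) set \<Rightarrow> 'a set \<Rightarrow> 'a set \<Rightarrow> 'a set \<Rightarrow> 'a set" where
  "attr E P B X = {v. v \<in> B \<or> (v \<in> P \<and> (\<exists>w\<in>X. (v, w) \<in> E)) \<or>
     ((\<exists>w\<in>X. (v, w) \<in> E) \<and> (\<forall>w. (v, w) \<in> E \<longrightarrow> w \<in> X))}"

definition pre :: "('a \<times> 'a) set \<Rightarrow> 'a set \<Rightarrow> 'a set" where
  "pre E X = {v. \<exists>w\<in>X. (v, w) \<in> E}"

lemma grab_win_Suc: "grab_win E P B n v \<Longrightarrow> grab_win E P B (Suc n) v"
  by (induction rule: grab_win.induct) (auto intro: grab_win.intros)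

lemma grab_win_mono_grabs: "grab_win E P B n v \<Longrightarrow> n \<le> m \<Longrightarrow> grab_win E P B m v"
  by (induction m) (auto simp: le_Suc_eq intro: grab_win_Suc)

lemma attr_grab_win: "attr E P B {v. grab_win E P B n v} \<subseteq> {v. grab_win E P B n v}"
  by (auto simp: attr_def intro: grab_win.intros)

text \<open>Once pawn \<open>j\<close> has been used to move to a vertex of cost \<open>m\<close>, buying \<open>j\<close> on the first
  visit suffices; hence the extra grab is only needed for costs at least \<open>m\<close>.\<close>
lemma grab_win_insert_aux:
  assumes "grab_win E (insert j P) B n v"
  shows "grab_win E P B n v \<or>
    (\<exists>m\<le>n. \<exists>w. (j, w) \<in> E \<and> grab_win E P B m w) \<and> grab_win E P B (Suc n) v"
  using assms
proof (induction rule: grab_win.induct)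
  case (base v n)
  then show ?case by (auto intro: grab_win.base)
next
  case (own v w n)
  \<comment> \<open>For \<open>v = j\<close>, either \<open>w\<close> itself or the witness from the
    induction hypothesis serves, and one grab of \<open>j\<close> pays for the move.\<close>
  then show ?case
    by (auto intro: grab_win.own grab_win.grab dest: grab_win_mono_grabs)
next
  case (all v w n)
  show ?case
  proof (cases "\<forall>u. (v, u) \<in> E \<longrightarrow> grab_win E P B n u")
    case True
    then show ?thesis using all.hyps by (auto intro: grab_win.all)
  next
    case False
    \<comment> \<open>A successor not won with \<open>n\<close> grabs supplies the witness
      \<open>m\<close>, while all successors are won with \<open>Suc n\<close>.\<close>
    then show ?thesis using all grab_win_Suc grab_win.all by metis
  qed
next
  case (grab v w n)
  then show ?case using grab_win.grab le_SucI by metis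
qed

lemma grab_win_insert: "grab_win E (insert j P) B n v \<Longrightarrow> grab_win E P B (Suc n) v"
  using grab_win_insert_aux grab_win_Suc by metis

text \<open>Derivations over \<open>B\<close> replace the leaves of a derivation over
  \<open>B'\<close>. A branch has only one leaf, so \<open>m\<close> is added once.\<close>

lemma grab_win_base_subset:
  assumes "grab_win E P B' n v" "\<And>u. u \<in> B' \<Longrightarrow> grab_win E P B m u"
  shows "grab_win E P B (n + m) v"
  using assms(1)
  by (induction rule: grab_win.induct)
    (auto intro: grab_win.intros grab_win_mono_grabs[OF assms(2)])

text \<open>Vertices won without grabs may join the base at no cost; this lets attractor rounds
  enlarge the base step by step.\<close>

lemma grab_win_base_cong:
  assumes "B \<subseteq> B'" "\<And>u. u \<in> B' \<Longrightarrow> grab_win E P B 0 u"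
  shows "grab_win E P B' n v = grab_win E P B n v"
  using grab_win_base_subset[of E P B' n v B 0] grab_win_base_subset[of E P B n v B' 0] assms
  by (auto intro: grab_win.base)

lemma attr_closed_own: "attr E P B X \<subseteq> X \<Longrightarrow> v \<in> P \<Longrightarrow> (v, w) \<in> E \<Longrightarrow> w \<in> X \<Longrightarrow> v \<in> X"
  by (erule subsetD) (auto simp: attr_def)

lemma attr_closed_all:
  assumes "attr E P B X \<subseteq> X" "(v, w) \<in> E" "\<And>u. (v, u) \<in> E \<Longrightarrow> u \<in> X"
  shows "v \<in> X"
proof -
  have "v \<in> attr E P B X" using assms(2,3) by (auto simp: attr_def)
  then show ?thesis using assms(1) by blast
qed

text \<open>With no grab left only \<open>base\<close>, \<open>own\<close> and \<open>all\<close>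
  apply, and a closed \<open>B\<close> absorbs all three.\<close>

lemma grab_win_closed_0:
  assumes "attr E P B B \<subseteq> B" "grab_win E P B 0 v"
  shows "v \<in> B"
proof -
  have "n = 0 \<longrightarrow> v \<in> B" if "grab_win E P B n v" for n
    using that
    by (induction rule: grab_win.induct)
      (auto intro: attr_closed_own[OF assms(1)] attr_closed_all[OF assms(1)])
  then show ?thesis using assms(2) by blast
qed

text \<open>The grab that exhausts the budget leads to a vertex won for free, hence into the closed
  set \<open>B\<close>. So it can be absorbed into the base as \<open>pre E B\<close>.\<close>

lemma grab_win_closed_Suc:
  assumes cl: "attr E P B B \<subseteq> B"
  shows "grab_win E P B (Suc n) v = grab_win E P (B \<union> pre E B) n v"
proof
  \<comment> \<open>Budget 0 is part of the induction because the rule \<open>grab\<close> with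
    \<open>n = 0\<close> needs it for the successor.\<close>
  have "(m = 0 \<longrightarrow> v \<in> B) \<and> (\<forall>n. m = Suc n \<longrightarrow> grab_win E P (B \<union> pre E B) n v)" if "grab_win E P B m v"
      for m v
    using that
  proof (induction rule: grab_win.induct)
    case (base v n)
    then show ?case by (auto intro: grab_win.base)
  next
    case (own v w n)
    then show ?case by (auto intro: grab_win.own attr_closed_own[OF cl])
  next
    case (all v w n)
    then show ?case by (auto intro: grab_win.all attr_closed_all[OF cl])
  next
    case (grab v w n)
    then show ?case by (cases n) (auto simp: pre_def intro: grab_win.base grab_win.grab)
  qed
  then show "grab_win E P B (Suc n) v \<Longrightarrow> grab_win E P (B \<union> pre E B) n v" by blast
next
  assume "grab_win E P (B \<union> pre E B) n v"
  then show "grab_win E P B (Suc n) v"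
    using grab_win_base_subset[of E P "B \<union> pre E B" n v B 1]
    by (auto simp: pre_def intro: grab_win.base grab_win.grab)
qed

text \<open>If neither kind of step adds a vertex, more grabs win nothing more; this justifies
  stopping before \<open>r\<close> is used up.\<close>

lemma grab_win_closed_pre:
  assumes "attr E P B B \<subseteq> B" "pre E B \<subseteq> B"
  shows "grab_win E P B n v \<longleftrightarrow> v \<in> B"
proof
  show "grab_win E P B n v \<Longrightarrow> v \<in> B"
    by (induction rule: grab_win.induct)
      (use assms(2) in \<open>auto simp: pre_def intro: attr_closed_own[OF assms(1)] attr_closed_all[OF
          assms(1)]\<close>)
qed (rule grab_win.base)

section \<open>Strategies\<close>

definition grab_opts :: "game \<Rightarrow> nat set \<Rightarrow> nat \<Rightarrow> nat option set" where
  "grab_opts G Q r = insert None (Some ` {j. j < gd G \<and> j \<notin> Q \<and> 0 < r})"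

fun arrive :: "nat \<Rightarrow> nat set \<Rightarrow> nat \<Rightarrow> nat option \<Rightarrow> conf" where
  "arrive u Q r None = (u, Q, r)"
| "arrive u Q r (Some j) = (u, insert j Q, r - 1)"

text \<open>\<open>t\<close> bounds the number of moves until the target is visited. In
  \<open>opp\<close> the grab is chosen after the move, so it may depend on
  \<open>u\<close>.\<close>

inductive good :: "game \<Rightarrow> nat \<Rightarrow> conf \<Rightarrow> bool" for G where
  target: "v \<in> gT G \<Longrightarrow> good G t (v, Q, r)"
| own: "v \<in> Q \<Longrightarrow> (v, u) \<in> gE G \<Longrightarrow> a \<in> grab_opts G Q r \<Longrightarrow> good G t (arrive u Q r a)
    \<Longrightarrow> good G (Suc t) (v, Q, r)"
| opp: "v \<notin> Q \<Longrightarrow> has_succ G v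
    \<Longrightarrow> (\<And>u. (v, u) \<in> gE G \<Longrightarrow> \<exists>a\<in>grab_opts G Q r. good G t (arrive u Q r a))
    \<Longrightarrow> good G (Suc t) (v, Q, r)"

lemma good_Suc: "good G t c \<Longrightarrow> good G (Suc t) c"
proof (induction rule: good.induct)
  case (opp v Q r t)
  then show ?case by (intro good.opp) blast+
qed (auto intro: good.intros)

lemma good_mono: "good G t c \<Longrightarrow> t \<le> s \<Longrightarrow> good G s c"
  by (induction s) (auto simp: le_Suc_eq intro: good_Suc)

text \<open>One bound must serve all successors; as there are finitely many, the maximum of their
  bounds does.\<close>

lemma good_opp:
  assumes "wf_game G" "v \<notin> Q" "has_succ G v"
    and "\<And>u. (v, u) \<in> gE G \<Longrightarrow> \<exists>a\<in>grab_opts G Q r. \<exists>t. good G t (arrive u Q r a)"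
  shows "\<exists>t. good G t (v, Q, r)"
proof -
  obtain a t where at: "\<And>u. (v, u) \<in> gE G \<Longrightarrow> a u \<in> grab_opts G Q r \<and> good G (t u) (arrive u Q r
      (a u))"
    using assms(4) by metis
  have "finite {u. (v, u) \<in> gE G}"
    by (rule finite_subset[of _ "{..<gd G}"]) (use assms(1) in \<open>auto simp: wf_game_def\<close>)
  then have "t u \<le> Max (t ` {u. (v, u) \<in> gE G})" if "(v, u) \<in> gE G" for u
    using that by simp
  then show ?thesis
    using assms(2,3) at by (blast intro: good.opp good_mono)
qed

text \<open>A grab of an arbitrary pawn costs one and, by \<open>grab_win_insert\<close>, saves at
  most one. So no strategy beats grabbing only vertices just reached.\<close>

lemma good_attr:
  assumes "good G t (v, Q, r)"
  shows "v \<in> attr (gE G) Q (gT G) {w. grab_win (gE G) Q (gT G) r w}"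
  using assms
proof (induction t "(v, Q, r)" arbitrary: v Q r rule: good.induct)
  case (target v t Q r)
  then show ?case by (simp add: attr_def)
next
  have arr: "grab_win (gE G) Q (gT G) r u"
    if "a \<in> grab_opts G Q r"
      "\<And>v' Q' r'. arrive u Q r a = (v', Q', r')
        \<Longrightarrow> v' \<in> attr (gE G) Q' (gT G) {w. grab_win (gE G) Q' (gT G) r' w}" for a u Q r
  proof (cases a)
    case None
    then show ?thesis using that(2) attr_grab_win[of "gE G" Q "gT G" r] by auto
  next
    case (Some j)
    then have "grab_win (gE G) (insert j Q) (gT G) (r - 1) u"
      using that(2) attr_grab_win[of "gE G" "insert j Q" "gT G" "r - 1"] by auto
    moreover have "0 < r" using Some that(1) by (auto simp: grab_opts_def)
    ultimately show ?thesis using grab_win_insert[of "gE G" j Q "gT G" "r - 1" u] by simp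
  qed
  {
    case (own v Q u a r t)
    then show ?case using arr[of a Q r u] by (auto simp: attr_def)
  next
    case (opp v Q r t)
    have "grab_win (gE G) Q (gT G) r u" if "(v, u) \<in> gE G" for u
      using opp(3)[OF that] arr by metis
    then show ?case using opp(2) by (auto simp: attr_def has_succ_def)
  }
qed

text \<open>The rule \<open>grab\<close> is played by taking the vertex just reached.
  \<open>Q\<close> and \<open>r\<close> may exceed \<open>P\<close> and \<open>n\<close>, since
  grabbed pawns stay with Player 1 and a revisited vertex is not paid for again.\<close>

lemma grab_win_good:
  assumes wf: "wf_game G" and "grab_win (gE G) P (gT G) n v" and "P \<subseteq> Q" and "n \<le> r"
  shows "\<exists>a\<in>grab_opts G Q r. \<exists>t. good G t (arrive v Q r a)"
  using assms(2-)
proof (induction arbitrary: Q r rule: grab_win.induct)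
  case (base v n)
  then have "good G 0 (arrive v Q r None)" by (simp add: good.target)
  then show ?case by (auto simp: grab_opts_def)
next
  case (own v w n)
  then obtain a t where "a \<in> grab_opts G Q r" "good G t (arrive w Q r a)" by blast
  then have "good G (Suc t) (arrive v Q r None)" using own by (auto intro: good.own)
  then show ?case by (auto simp: grab_opts_def)
next
  case (all v w n)
  have ex: "\<exists>t. good G t (v, Q, r)"
  proof (cases "v \<in> Q")
    case True
    then show ?thesis using all by (blast intro: good.own)
  next
    case False
    then show ?thesis using all by (intro good_opp[OF wf]) (auto simp: has_succ_def)
  qed
  then have "\<exists>t. good G t (arrive v Q r None)" by simp
  then show ?case by (auto simp: grab_opts_def)
next
  case (grab v w n)
  show ?case
  proof (cases "v \<in> Q")
    case True
    obtain a t where "a \<in> grab_opts G Q r" "good G t (arrive w Q r a)"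
      using grab.IH[of Q r] grab.prems by auto
    then have "good G (Suc t) (arrive v Q r None)" using True grab by (auto intro: good.own)
    then show ?thesis by (auto simp: grab_opts_def)
  next
    case False
    have "P \<subseteq> insert v Q" "n \<le> r - 1" using grab.prems by auto
    from grab.IH[OF this] obtain a t where "a \<in> grab_opts G (insert v Q) (r - 1)"
        "good G t (arrive w (insert v Q) (r - 1) a)"
      by blast
    then have "good G (Suc t) (arrive v Q r (Some v))" using grab by (auto intro: good.own)
    moreover have "Some v \<in> grab_opts G Q r"
      using wf grab False by (auto simp: grab_opts_def wf_game_def)
    ultimately show ?thesis by blast
  qed
qed

lemma attr_good:
  assumes wf: "wf_game G" and v: "v \<in> attr (gE G) P (gT G) {w. grab_win (gE G) P (gT G) r w}"
  shows "\<exists>t. good G t (v, P, r)"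
proof -
  consider "v \<in> gT G" | w where "v \<in> P" "(v, w) \<in> gE G" "grab_win (gE G) P (gT G) r w"
    | "v \<notin> P" "has_succ G v" "\<forall>w. (v, w) \<in> gE G \<longrightarrow> grab_win (gE G) P (gT G) r w"
    using v by (auto simp: attr_def has_succ_def)
  then show ?thesis
  proof cases
    case 1
    then show ?thesis by (auto intro: good.target)
  next
    case 2
    then show ?thesis using grab_win_good[OF wf 2(3), of P r] by (blast intro: good.own)
  next
    case 3
    then show ?thesis using grab_win_good[OF wf, of P r] by (intro good_opp[OF wf]) auto
  qed
qed

section \<open>From bounds on the play length to strategies on histories\<close>

lemma next_hist_arrive:
  assumes "last h = (v, Q, r)" "has_succ G v"
  shows "next_hist G m1 g m2 h =
    h @ [let u = if v \<in> Q then m1 h else m2 h in arrive u Q r (g h u)]"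
  using assms by (auto simp: next_hist_def Let_def split: option.split)

lemma play_prefix_Suc:
  "play_prefix G m1 g m2 c (Suc n) = next_hist G m1 g m2 (play_prefix G m1 g m2 c n)"
  by (simp add: play_prefix_def)

lemma play_prefix_nonempty: "play_prefix G m1 g m2 c n \<noteq> []"
proof (induction n)
  case (Suc n)
  then show ?case unfolding play_prefix_Suc
    by (auto simp: next_hist_def Let_def split: prod.split option.split)
qed (simp add: play_prefix_def)

text \<open>A positional strategy that lowers the least bound \<open>rk\<close> with every move
  visits the target within \<open>rk c0\<close> moves.\<close>

lemma good_wins:
  assumes "good G t c0"
  shows "P1_wins G k c0"
proof -
  define rk where "rk c = (LEAST t. good G t c)" for c
  \<comment> \<open>The fallback, an arbitrary successor, keeps the strategy legal on all
    histories.\<close>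
  define mv where "mv c = (case c of (v, Q, r) \<Rightarrow> if \<exists>u. (v, u) \<in> gE G \<and>
      (\<exists>a\<in>grab_opts G Q r. good G (rk c - 1) (arrive u Q r a))
    then SOME u. (v, u) \<in> gE G \<and> (\<exists>a\<in>grab_opts G Q r. good G (rk c - 1) (arrive u Q r a))
    else SOME u. (v, u) \<in> gE G)" for c
  define gr where "gr c u = (case c of (v, Q, r) \<Rightarrow>
      if \<exists>a\<in>grab_opts G Q r. good G (rk c - 1) (arrive u Q r a)
      then SOME a. a \<in> grab_opts G Q r \<and> good G (rk c - 1) (arrive u Q r a) else None)" for c u
  define m1 where "m1 h = mv (last h)" for h
  define g where "g h u = gr (last h) u" for h u
  have mvE: "(v, mv (v, Q, r)) \<in> gE G" if "has_succ G v" for v Q r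
  proof (cases "\<exists>u. (v, u) \<in> gE G \<and> (\<exists>a\<in>grab_opts G Q r. good G (rk (v, Q, r) - 1)
      (arrive u Q r a))")
    case True
    from someI_ex[OF this] show ?thesis using True by (simp add: mv_def)
  next
    case False
    then show ?thesis using that someI_ex[of "\<lambda>u. (v, u) \<in> gE G"]
      by (auto simp: mv_def has_succ_def)
  qed
  have mv_good: "\<exists>a\<in>grab_opts G Q r. good G (rk (v, Q, r) - 1) (arrive (mv (v, Q, r)) Q r a)"
    if "(v, u) \<in> gE G" "a \<in> grab_opts G Q r" "good G (rk (v, Q, r) - 1) (arrive u Q r a)"
        for v Q r u a
  proof -
    have ex: "\<exists>u. (v, u) \<in> gE G \<and> (\<exists>a\<in>grab_opts G Q r. good G (rk (v, Q, r) - 1) (arrive u Q r a))"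
      using that by blast
    from someI_ex[OF this] show ?thesis using ex by (simp add: mv_def)
  qed
  have gr_opt: "gr (v, Q, r) u \<in> grab_opts G Q r" for v Q r u
  proof (cases "\<exists>a\<in>grab_opts G Q r. good G (rk (v, Q, r) - 1) (arrive u Q r a)")
    case True
    then have "\<exists>a. a\<in>grab_opts G Q r \<and> good G (rk (v, Q, r) - 1) (arrive u Q r a)" by blast
    from someI_ex[OF this] show ?thesis using True by (simp add: gr_def)
  next
    case False
    then have "gr (v, Q, r) u = None" by (simp add: gr_def)
    then show ?thesis by (simp add: grab_opts_def)
  qed
  have gr_good: "good G (rk (v, Q, r) - 1) (arrive u Q r (gr (v, Q, r) u))"
    if "\<exists>a\<in>grab_opts G Q r. good G (rk (v, Q, r) - 1) (arrive u Q r a)" for v Q r u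
  proof -
    have "\<exists>a. a\<in>grab_opts G Q r \<and> good G (rk (v, Q, r) - 1) (arrive u Q r a)" using that by blast
    from someI_ex[OF this] show ?thesis using that by (simp add: gr_def)
  qed
  have "legal_move_strat G m1"
    using mvE by (auto simp: legal_move_strat_def m1_def) (metis prod.collapse)
  moreover have "legal_grab_strat G g"
    unfolding legal_grab_strat_def
  proof (intro allI impI)
    fix h u j assume "g h u = Some j"
    moreover obtain v Q r where l: "last h = (v, Q, r)" by (metis prod.exhaust)
    ultimately show "case last h of (v, P, r) \<Rightarrow> j < gd G \<and> j \<notin> P \<and> 0 < r"
      using gr_opt[of v Q r u] by (auto simp: g_def grab_opts_def)
  qed
  moreover have "visits_target G m1 g m2 c0" if m2: "legal_move_strat G m2" for m2
  proof (rule ccontr)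
    assume no: "\<not> visits_target G m1 g m2 c0"
    let ?h = "play_prefix G m1 g m2 c0"
    have noT: "fst (last (?h n)) \<notin> gT G" for n
      using no last_in_set[OF play_prefix_nonempty] unfolding visits_target_def by blast
    have "\<exists>t. t + n \<le> rk c0 \<and> good G t (last (?h n))" for n
    proof (induction n)
      case 0
      then show ?case using assms LeastI[of "\<lambda>t. good G t c0"]
        by (auto simp: play_prefix_def rk_def)
    next
      case (Suc n)
      obtain v Q r where l: "last (?h n) = (v, Q, r)" by (metis prod.exhaust)
      from Suc obtain t where t: "t + n \<le> rk c0" "good G t (v, Q, r)" by (auto simp: l)
      have rkt: "rk (v, Q, r) \<le> t" unfolding rk_def by (rule Least_le) (rule t)
      have "good G (rk (v, Q, r)) (v, Q, r)" unfolding rk_def by (rule LeastI) (rule t)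
      moreover have "v \<notin> gT G" using noT[of n] l by simp
      ultimately obtain s where s: "rk (v, Q, r) = Suc s" and hs: "has_succ G v"
        and ex: "if v \<in> Q then \<exists>u a. (v, u) \<in> gE G \<and> a \<in> grab_opts G Q r \<and> good G s (arrive u Q r a)
          else \<forall>u. (v, u) \<in> gE G \<longrightarrow> (\<exists>a\<in>grab_opts G Q r. good G s (arrive u Q r a))"
        by cases (auto simp: has_succ_def)
      define u where "u = (if v \<in> Q then m1 (?h n) else m2 (?h n))"
      have "\<exists>a\<in>grab_opts G Q r. good G (rk (v, Q, r) - 1) (arrive u Q r a)"
      proof (cases "v \<in> Q")
        case True
        then show ?thesis using ex mv_good[of v _ _ Q r] by (auto simp: u_def m1_def l s)
      next
        case False
        have "(v, m2 (?h n)) \<in> gE G"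
          using m2 play_prefix_nonempty l hs unfolding legal_move_strat_def by (metis fst_conv)
        then show ?thesis using ex False by (simp add: u_def s)
      qed
      then have "good G s (arrive u Q r (gr (v, Q, r) u))" using gr_good s by fastforce
      moreover have "last (?h (Suc n)) = arrive u Q r (gr (v, Q, r) u)"
        unfolding play_prefix_Suc next_hist_arrive[OF l hs] by (simp add: u_def g_def l Let_def)
      ultimately show ?case using t(1) rkt s by (intro exI[of _ s]) auto
    qed
    from this[of "Suc (rk c0)"] show False by auto
  qed
  ultimately show ?thesis unfolding P1_wins_def by blast
qed

text \<open>By contraposition of \<open>good_opp\<close>, Player 2 can move to a vertex that is bad
  whatever grab follows. Thus he never leaves the configurations that have no bound.\<close>

lemma wins_good:
  assumes wf: "wf_game G" and "P1_wins G k c0"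
  shows "\<exists>t. good G t c0"
proof (rule ccontr)
  assume bad: "\<nexists>t. good G t c0"
  define winning where "winning c \<longleftrightarrow> (\<exists>t. good G t c)" for c
  obtain m1 g where m1: "legal_move_strat G m1" and g: "legal_grab_strat G g"
    and win: "\<And>m2. legal_move_strat G m2 \<Longrightarrow> visits_target G m1 g m2 c0"
    using assms(2) unfolding P1_wins_def by blast
  define mv where "mv c = (case c of (v, Q, r) \<Rightarrow>
    if \<exists>u. (v, u) \<in> gE G \<and> (\<forall>a\<in>grab_opts G Q r. \<not> winning (arrive u Q r a))
    then SOME u. (v, u) \<in> gE G \<and> (\<forall>a\<in>grab_opts G Q r. \<not> winning (arrive u Q r a))
    else SOME u. (v, u) \<in> gE G)" for c
  define m2 where "m2 h = mv (last h)" for h :: "conf list"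
  have mvE: "(v, mv (v, Q, r)) \<in> gE G" if "has_succ G v" for v Q r
  proof (cases "\<exists>u. (v, u) \<in> gE G \<and> (\<forall>a\<in>grab_opts G Q r. \<not> winning (arrive u Q r a))")
    case True
    from someI_ex[OF this] show ?thesis using True by (simp add: mv_def)
  next
    case False
    then show ?thesis using that someI_ex[of "\<lambda>u. (v, u) \<in> gE G"]
      by (auto simp: mv_def has_succ_def)
  qed
  have mv_bad: "\<not> winning (arrive (mv (v, Q, r)) Q r a)"
    if "v \<notin> Q" "\<not> winning (v, Q, r)" "has_succ G v" "a \<in> grab_opts G Q r" for v Q r a
  proof -
    have ex: "\<exists>u. (v, u) \<in> gE G \<and> (\<forall>a\<in>grab_opts G Q r. \<not> winning (arrive u Q r a))"
      using that good_opp[OF wf that(1,3), of r] unfolding winning_def by blast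
    from someI_ex[OF this] show ?thesis using ex that(4) by (simp add: mv_def)
  qed
  have leg: "legal_move_strat G m2"
    using mvE by (auto simp: legal_move_strat_def m2_def) (metis prod.collapse)
  let ?h = "play_prefix G m1 g m2 c0"
  have "\<forall>c\<in>set (?h n). \<not> winning c" for n
  proof (induction n)
    case 0
    then show ?case using bad by (simp add: play_prefix_def winning_def)
  next
    case (Suc n)
    obtain v Q r where l: "last (?h n) = (v, Q, r)" by (metis prod.exhaust)
    have ne: "?h n \<noteq> []" by (rule play_prefix_nonempty)
    have nb: "\<not> winning (v, Q, r)" using Suc last_in_set[OF ne] l by simp
    show ?case
    proof (cases "has_succ G v")
      case False
      then have "?h (Suc n) = ?h n" unfolding play_prefix_Suc by (simp add: next_hist_def l)
      then show ?thesis using Suc by simp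
    next
      case True
      have opt: "g (?h n) u \<in> grab_opts G Q r" for u
        using g ne l by (cases "g (?h n) u") (fastforce simp: legal_grab_strat_def grab_opts_def)+
      have "\<not> winning (arrive u Q r (g (?h n) u))" if "u = (if v \<in> Q then m1 (?h n) else m2 (?h n))"
          for u
      proof (cases "v \<in> Q")
        case True
        have "(v, m1 (?h n)) \<in> gE G"
          using m1 ne l \<open>has_succ G v\<close> unfolding legal_move_strat_def by (metis fst_conv)
        then show ?thesis using that nb True opt unfolding winning_def by (auto intro: good.own)
      next
        case False
        then show ?thesis using that mv_bad[OF False nb True opt] by (simp add: m2_def l)
      qed
      then show ?thesis unfolding play_prefix_Suc next_hist_arrive[OF l True] using Suc
        by (simp add: Let_def)
    qed
  qed
  then show False using win[OF leg] unfolding visits_target_def winning_def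
    by (metis good.target prod.collapse)
qed

lemma P1_wins_iff:
  assumes "wf_game G"
  shows "P1_wins G k (v, P, r) \<longleftrightarrow> v \<in> attr (gE G) P (gT G) {w. grab_win (gE G) P (gT G) r w}"
  using wins_good[OF assms] good_wins good_attr attr_good[OF assms] by metis

section \<open>Machines over finite types\<close>

text \<open>Mirrors \<open>tm_step\<close> over arbitrary types, so that the machine can be written
  with datatypes and numbered afterwards.\<close>

definition gstep :: "'q set \<Rightarrow> ('q \<Rightarrow> 'a \<Rightarrow> 'q \<times> 'a \<times> nat) \<Rightarrow> 'q \<times> (int \<Rightarrow> 'a) \<times> int \<Rightarrow> 'q \<times>
    (int \<Rightarrow> 'a) \<times> int"
  where
  "gstep H \<delta> c = (case c of (q, tp, pos) \<Rightarrow> if q \<in> H then c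
     else (case \<delta> q (tp pos) of (q', a, mv) \<Rightarrow> (q', tp(pos := a), pos + int mv - 1)))"

definition tape :: "'a \<Rightarrow> 'a list \<Rightarrow> int \<Rightarrow> 'a" where
  "tape b xs i = (if 0 \<le> i \<and> i < int (length xs) then xs ! nat i else b)"

lemma ex_numbering:
  fixes a b c :: "'a::finite"
  assumes "distinct [a, b, c]"
  shows "\<exists>f n. inj f \<and> (\<forall>x. f x < n) \<and> (3::nat) \<le> n \<and> f a = 0 \<and> f b = 1 \<and> f c = 2"
proof -
  obtain xs where xs: "set xs = UNIV - {a, b, c}" "distinct xs"
    using finite_distinct_list[of "UNIV - {a, b, c}"] by auto
  \<comment> \<open>Coming first, \<open>a\<close>, \<open>b\<close>, \<open>c\<close> get the
    numbers 0, 1, 2 that the machine model reserves for special states and symbols.\<close>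
  define ys where "ys = [a, b, c] @ xs"
  have ys: "set ys = UNIV" "distinct ys" using xs assms by (auto simp: ys_def)
  define f where "f x = (THE i. i < length ys \<and> ys ! i = x)" for x
  have f: "f x < length ys \<and> ys ! f x = x" for x
    unfolding f_def
  proof (rule theI')
    have "\<exists>i. i < length ys \<and> ys ! i = x" using ys(1) by (metis UNIV_I in_set_conv_nth)
    then show "\<exists>!i. i < length ys \<and> ys ! i = x" using ys(2) by (auto simp: nth_eq_iff_index_eq)
  qed
  have fn: "f (ys ! i) = i" if "i < length ys" for i
    using f[of "ys ! i"] ys(2) that by (metis nth_eq_iff_index_eq)
  have "inj f" using f by (metis injI)
  moreover have "f a = 0" "f b = 1" "f c = 2" using fn[of 0] fn[of 1] fn[of 2]
    by (simp_all add: ys_def)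
  moreover have "3 \<le> length ys" by (simp add: ys_def)
  ultimately show ?thesis using f by blast
qed

lemma ex_tm:
  fixes \<delta> :: "'q::finite \<Rightarrow> 'a::finite \<Rightarrow> 'q \<times> 'a \<times> nat"
  assumes "distinct [q0, qa, qr]" "distinct [b, s0, s1]" "\<And>q a. snd (snd (\<delta> q a)) \<le> 2"
  shows "\<exists>M. wf_tm M \<and> (\<forall>w t.
    let q = fst ((gstep {qa, qr} \<delta> ^^ t) (q0, tape b (map (\<lambda>x. if x then s1 else s0) w), 0));
        q' = fst ((tm_step M ^^ t) (tm_init w))
    in (q = qa \<longrightarrow> q' = 1) \<and> (q = qr \<longrightarrow> q' = 2))"
proof -
  obtain fq :: "'q \<Rightarrow> nat" and n where fq: "inj fq" "\<And>x. fq x < n" "3 \<le> n" "fq q0 = 0" "fq qa = 1"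
      "fq qr = 2"
    using ex_numbering[OF assms(1)] by blast
  obtain fa :: "'a \<Rightarrow> nat" and k where fa: "inj fa" "\<And>x. fa x < k" "3 \<le> k" "fa b = 0" "fa s0 = 1"
      "fa s1 = 2"
    using ex_numbering[OF assms(2)] by blast
  \<comment> \<open>On numbers that code nothing, \<open>inv\<close> yields some element, so even
    there the results are codes within bounds.\<close>
  define M where "M = \<lparr>nstates = n, nsyms = k, delta = (\<lambda>q s.
    case \<delta> (inv fq q) (inv fa s) of (q', a, mv) \<Rightarrow> (fq q', fa a, mv))\<rparr>"
  define enc where "enc c = (case c of (q, tp, pos) \<Rightarrow> (fq q, fa \<circ> tp, pos))"
    for c :: "'q \<times> (int \<Rightarrow> 'a) \<times> int"
  have "wf_tm M" using fq fa assms(3)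
    by (auto simp: wf_tm_def M_def split: prod.split) (metis snd_conv)
  moreover have step: "tm_step M (enc c) = enc (gstep {qa, qr} \<delta> c)" for c
  proof -
    obtain q tp pos where c: "c = (q, tp, pos)" by (metis prod.exhaust)
    have "fq q = 1 \<longleftrightarrow> q = qa" "fq q = 2 \<longleftrightarrow> q = qr"
      using fq by (metis inj_eq)+
    then show ?thesis
      by (auto simp: c enc_def tm_step_def gstep_def M_def inv_f_f[OF fq(1)] inv_f_f[OF fa(1)]
          fun_upd_comp split: prod.split)
  qed
  have run: "(tm_step M ^^ t) (enc c) = enc ((gstep {qa, qr} \<delta> ^^ t) c)" for t c
    by (induction t) (auto simp: step)
  have init: "tm_init w = enc (q0, tape b (map (\<lambda>x. if x then s1 else s0) w), 0)" for w
    by (auto simp: tm_init_def enc_def tape_def fq fa fun_eq_iff)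
  have fst_enc: "fst (enc c) = fq (fst c)" for c by (simp add: enc_def split: prod.split)
  show ?thesis
    by (rule exI[of _ M]) (simp add: \<open>wf_tm M\<close> init run fst_enc fq Let_def)
qed

section \<open>The deciding machine\<close>

text \<open>The sections of the input are the matrix \<open>SM\<close>, the sets \<open>T\<close> and \<open>P\<close>, and the numbers \<open>v\<close>, \<open>r\<close>
  and \<open>k\<close>; \<open>S0\<close> is what precedes the first separator when reading from the right end.\<close>
datatype sec = S0 | SM | ST | SP | SV | SR | SK

text \<open>\<open>Cell s e x y p\<close> carries the input bit \<open>e\<close>. In column \<open>j\<close> of the matrix and of the two sets,
  \<open>x\<close> and \<open>y\<close> say whether \<open>j\<close> belongs to the current set \<open>X\<close> of winning vertices and to its
  successor \<open>Y\<close>, and \<open>p\<close> whether \<open>j\<close> is the vertex under examination; the mark in \<open>Sep s k\<close>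
  singles out the row of that vertex. An input letter occupies two tape squares, the first of which
  becomes \<open>Fill\<close>.\<close>
datatype sym = Blank | Bit bool | Fill | Raw bool | RawSep
  | Cell sec bool bool bool bool | Sep sec bool

text \<open>A round of mode \<open>Attr\<close> adds the vertices won without a further grab, one of mode \<open>Grab\<close> those
  won by grabbing them; \<open>Final\<close> searches for the initial vertex.\<close>
datatype mode = Attr | Grab | Final

datatype flag = On | Any | Nall | Pf | Tf | Ch | Vnz | Rnz

text \<open>In \<open>Upd m w b cp cm bv br\<close>, \<open>w\<close> starts a new round (\<open>X := Y\<close>, pointer back to column 0),
  \<open>b\<close> adds the examined vertex to \<open>Y\<close>, \<open>cp\<close> and \<open>cm\<close> delay pointer and row mark by one
  position, and \<open>bv\<close>, \<open>br\<close> are the borrows of the decrements of \<open>v\<close> and \<open>r\<close>.\<close>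
datatype state = Dec "bool option" | Acc | Rej | Lab sec
  | Scan mode bool "flag set" | Upd mode bool bool bool bool bool bool

instance sec :: finite
proof
  have "(UNIV :: sec set) \<subseteq> {S0, SM, ST, SP, SV, SR, SK}" using sec.exhaust by auto
  then show "finite (UNIV :: sec set)" by (rule finite_subset) simp
qed

instance mode :: finite
proof
  have "(UNIV :: mode set) \<subseteq> {Attr, Grab, Final}" using mode.exhaust by auto
  then show "finite (UNIV :: mode set)" by (rule finite_subset) simp
qed

instance flag :: finite
proof
  have "(UNIV :: flag set) \<subseteq> {On, Any, Nall, Pf, Tf, Ch, Vnz, Rnz}" using flag.exhaust by auto
  then show "finite (UNIV :: flag set)" by (rule finite_subset) simp
qed

instance sym :: finite
proof
  have "x \<in> {Blank, Fill, RawSep} \<union> range Bit \<union> range Raw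
      \<union> range (\<lambda>(s, e, x, y, p). Cell s e x y p) \<union> range (\<lambda>(s, k). Sep s k)" for x
    by (cases x) (auto simp: image_iff)
  then have "(UNIV :: sym set) \<subseteq> {Blank, Fill, RawSep} \<union> range Bit \<union> range Raw
      \<union> range (\<lambda>(s, e, x, y, p). Cell s e x y p) \<union> range (\<lambda>(s, k). Sep s k)" by blast
  then show "finite (UNIV :: sym set)" by (rule finite_subset) simp
qed

instance state :: finite
proof
  have "x \<in> {Acc, Rej} \<union> range Dec \<union> range Lab \<union> range (\<lambda>(m, c, A). Scan m c A)
      \<union> range (\<lambda>(m, w, b, cp, cm, bv, br). Upd m w b cp cm bv br)" for x
    by (cases x) (auto simp: image_iff)
  then have "(UNIV :: state set) \<subseteq> {Acc, Rej} \<union> range Dec \<union> range Lab \<union> range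
      (\<lambda>(m, c, A). Scan m c A)
      \<union> range (\<lambda>(m, w, b, cp, cm, bv, br). Upd m w b cp cm bv br)" by blast
  then show "finite (UNIV :: state set)" by (rule finite_subset) simp
qed

text \<open>Labels are assigned from right to left, one per separator. \<open>SM\<close> is a fixed
  point because every matrix row has its own separator.\<close>

fun prv :: "sec \<Rightarrow> sec" where
  "prv S0 = SK" | "prv SK = SR" | "prv SR = SV" | "prv SV = SP" | "prv SP = ST"
| "prv ST = SM" | "prv SM = SM"

text \<open>The flags that a symbol contributes to a scan; \<open>cur\<close> says whether the scan
  is inside the row of the examined vertex.\<close>

fun emit :: "bool \<Rightarrow> sym \<Rightarrow> flag set" where
  "emit cur (Cell s e x y p) = {f.
     f = Ch \<and> x \<noteq> y \<or> f = Any \<and> s = SM \<and> cur \<and> e \<and> x \<or> f = Nall \<and> s = SM \<and> cur \<and> e \<and> \<not> x \<or>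
     f = Tf \<and> s = ST \<and> p \<and> e \<or> f = Pf \<and> s = SP \<and> p \<and> e \<or> f = Vnz \<and> s = SV \<and> e \<or> f = Rnz \<and> s = SR
         \<and> e}"
| "emit cur (Sep s k) = {f. f = On \<and> k}"
| "emit cur _ = {}"

text \<open>A scan runs leftwards, so it meets a row's separator, and with it the mark, before the
  cells. In an update, writing \<open>cp\<close> moves the pointer one cell to the right, and a
  separator resets \<open>cp\<close> to \<open>w\<close>, which places the pointer at column 0 in a
  new round.\<close>

fun tr :: "state \<Rightarrow> sym \<Rightarrow> state \<times> sym" where
  "tr (Dec None) (Bit b) = (Dec (Some b), Fill)"
| "tr (Dec (Some a)) (Bit b) = (Dec None, if a then RawSep else Raw b)"
| "tr (Lab s) (Raw b) = (Lab s, Cell s b False False False)"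
| "tr (Lab s) RawSep = (Lab (prv s), Sep (prv s) False)"
| "tr (Scan m cur A) (Cell s e x y p) = (Scan m cur (A \<union> emit cur
    (Cell s e x y p)), Cell s e x y p)"
| "tr (Scan m cur A) (Sep s k) = (Scan m k (A \<union> emit cur (Sep s k)), Sep s k)"
| "tr (Upd m w b cp cm bv br) (Cell s e x y p) =
    (Upd m w b p cm (if s = SV then bv \<and> \<not> e else bv) (if s = SR then br \<and> \<not> e else br),
     Cell s (e \<noteq> (s = SV \<and> bv \<or> s = SR \<and> br)) (if w then y else x) (y \<or> p \<and> b)
       (cp \<and> s \<in> {SM, ST, SP}))"
| "tr (Upd m w b cp cm bv br) (Sep s k) = (Upd m w b w k bv br, Sep s (s = SM \<and> cm))"
| "tr q a = (q, a)"

abbreviation upd :: "mode \<Rightarrow> bool \<Rightarrow> bool \<Rightarrow> bool \<Rightarrow> bool \<Rightarrow> state" where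
  "upd m w b bv br \<equiv> Upd m w b w w bv br"

text \<open>\<open>Nall\<close> means that some successor is not in \<open>X\<close>, so \<open>Any\<close> without \<open>Nall\<close> says that there are
  successors and that all of them are in \<open>X\<close>.\<close>
definition attr_flags :: "flag set \<Rightarrow> bool" where
  "attr_flags A \<longleftrightarrow> Tf \<in> A \<or> Pf \<in> A \<and> Any \<in> A \<or> Any \<in> A \<and> Nall \<notin> A"

text \<open>Without \<open>On\<close> the pointer has passed the last column and the round is over.
  In mode \<open>Final\<close> the counter \<open>v\<close> falls as the pointer advances, so it is
  0 exactly when the initial vertex is under examination.\<close>

definition decide :: "mode \<Rightarrow> flag set \<Rightarrow> state" where
  "decide m A = (if On \<in> A
     then if m = Final \<and> Vnz \<notin> A then if attr_flags A then Acc else Rej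
       else upd m False (if m = Grab then Any \<in> A else attr_flags A) (m = Final) False
     else if m = Final then Rej
     else if Ch \<in> A then upd Attr True False False False
     else if m = Attr \<and> Rnz \<in> A then upd Grab True False False True
     else upd Final True False False False)"

fun turn :: "state \<Rightarrow> state" where
  "turn (Dec x) = Lab S0"
| "turn (Lab s) = upd Attr True False False False"
| "turn (Scan m cur A) = decide m A"
| "turn (Upd m w b cp cm bv br) = Scan m False {}"
| "turn q = q"

fun dir :: "state \<Rightarrow> nat" where
  "dir (Dec x) = 2"
| "dir (Upd m w b cp cm bv br) = 2"
| "dir (Lab s) = 0"
| "dir (Scan m cur A) = 0"
| "dir q = 1"

text \<open>Blanks delimit the word: there the head reverses and \<open>turn\<close> selects the
  next sweep.\<close>

definition trans :: "state \<Rightarrow> sym \<Rightarrow> state \<times> sym \<times> nat" where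
  "trans q a = (if a = Blank then (turn q, Blank, 2 - dir q)
     else (fst (tr q a), snd (tr q a), dir q))"

abbreviation stp where "stp \<equiv> gstep {Acc, Rej} trans"

section \<open>Sweeps as finite transducers on lists\<close>

lemma tr_Fill [simp]: "tr q Fill = (q, Fill)"
  by (cases q) (auto split: option.split simp: tr.simps)

lemma dir_tr [simp]: "dir (fst (tr q a)) = dir q"
  by (induction q a rule: tr.induct) simp_all

fun lr :: "state \<Rightarrow> sym list \<Rightarrow> state \<times> sym list" where
  "lr q [] = (q, [])"
| "lr q (x # xs) = (let (q1, y) = tr q x; (q2, ys) = lr q1 xs in (q2, y # ys))"

definition rl :: "state \<Rightarrow> sym list \<Rightarrow> state \<times> sym list" where
  "rl q xs = (let (q', ys) = lr q (rev xs) in (q', rev ys))"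

lemma lr_append:
  "lr q xs = (q1, xs') \<Longrightarrow> lr q1 ys = (q2, ys') \<Longrightarrow> lr q (xs @ ys) = (q2, xs' @ ys')"
  by (induction xs arbitrary: q q1 xs') (auto simp: Let_def split: prod.splits)

lemma rl_append:
  "rl q ys = (q1, ys') \<Longrightarrow> rl q1 xs = (q2, xs') \<Longrightarrow> rl q (xs @ ys) = (q2, xs' @ ys')"
  by (auto simp: rl_def Let_def split: prod.splits dest: lr_append)

lemma length_lr: "length (snd (lr q xs)) = length xs"
  by (induction xs arbitrary: q) (simp_all add: Let_def case_prod_beta)

lemma length_rl: "length (snd (rl q xs)) = length xs"
  by (simp add: rl_def Let_def case_prod_beta length_lr)

lemma dir_lr: "dir (fst (lr q xs)) = dir q"
  by (induction xs arbitrary: q) (simp_all add: Let_def case_prod_beta)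

definition fills :: "sym list \<Rightarrow> sym list" where
  "fills xs = concat (map (\<lambda>x. [Fill, x]) xs)"

lemma fills_simps [simp]:
  "fills [] = []" "fills (x # xs) = Fill # x # fills xs" "fills (xs @ ys) = fills xs @ fills ys"
  "length (fills xs) = 2 * length xs" "set (fills xs) = (if xs = [] then {} else insert Fill
      (set xs))"
  by (auto simp: fills_def) (induction xs; auto)+

text \<open>\<open>Fill\<close> changes neither state nor tape, so sweeps can be computed on the
  list without the filling squares.\<close>

lemma lr_fills: "lr q xs = (q', ys) \<Longrightarrow> lr q (fills xs) = (q', fills ys)"
  by (induction xs arbitrary: q q' ys) (auto simp: Let_def split: prod.splits)

lemma lr_rev_fills: "lr q xs = (q', ys) \<Longrightarrow> lr q (rev (fills (rev xs))) = (q', rev (fills (rev ys)))"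
  by (induction xs arbitrary: q q' ys) (auto simp: Let_def split: prod.splits)

lemma rl_fills: "rl q xs = (q', ys) \<Longrightarrow> rl q (fills xs) = (q', fills ys)"
  by (auto simp: rl_def Let_def split: prod.splits dest: lr_rev_fills)

lemma tape_at [simp]: "tape b (us @ x # xs) (int (length us)) = x"
  by (simp add: tape_def)

lemma tape_upd [simp]: "(tape b (us @ x # xs))(int (length us) := y) = tape b (us @ y # xs)"
  by (auto simp: tape_def fun_eq_iff nth_append nth_Cons')

lemma tape_blank [simp]: "tape b xs (int (length xs)) = b" "tape b xs (- 1) = b"
  by (simp_all add: tape_def)

lemma tape_upd_blank [simp]: "(tape b xs)(int (length xs) := b) = tape b xs"
  "(tape b xs)(- 1 := b) = tape b xs"
  by (auto simp: tape_def fun_eq_iff)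

text \<open>The direction is invariant under \<open>tr\<close>, so the head passes over every letter
  once. The prefix \<open>us\<close> collects the letters already rewritten.\<close>

lemma sweep_right:
  assumes "dir q = 2" "Blank \<notin> set xs" "lr q xs = (q', ys)"
  shows "(stp ^^ length xs) (q, tape Blank (us @ xs), int (length us))
    = (q', tape Blank (us @ ys), int (length (us @ xs)))"
  using assms
proof (induction xs arbitrary: us q ys)
  case (Cons x xs)
  obtain q1 y where xy: "tr q x = (q1, y)" by force
  obtain ys' where ys': "lr q1 xs = (q', ys')" "ys = y # ys'"
    using Cons.prems(3) by (auto simp: xy Let_def split: prod.splits)
  have "q \<notin> {Acc, Rej}" "x \<noteq> Blank" using Cons.prems by auto
  then have "stp (q, tape Blank (us @ x # xs), int (length us))
    = (q1, tape Blank ((us @ [y]) @ xs), int (length (us @ [y])))"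
    using Cons.prems by (simp add: gstep_def trans_def xy)
  moreover have "dir q1 = 2" using dir_tr[of q x] xy Cons.prems(1) by simp
  ultimately show ?case using Cons.IH[of q1 ys' "us @ [y]"] Cons.prems(2) ys'
    by (simp add: funpow_swap1 funpow_Suc_right del: funpow.simps)
qed simp

lemma sweep_left:
  assumes "dir q = 0" "Blank \<notin> set xs" "rl q xs = (q', ys)"
  shows "(stp ^^ length xs) (q, tape Blank (xs @ vs), int (length xs) - 1)
    = (q', tape Blank (ys @ vs), - 1)"
  using assms
proof (induction xs arbitrary: vs q ys rule: rev_induct)
  case (snoc x xs)
  obtain q1 y where xy: "tr q x = (q1, y)" by force
  obtain ys' where ys': "rl q1 xs = (q', ys')" "ys = ys' @ [y]"
    using snoc.prems(3) by (auto simp: xy rl_def Let_def split: prod.splits)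
  have "q \<notin> {Acc, Rej}" "x \<noteq> Blank" using snoc.prems by auto
  then have "stp (q, tape Blank (xs @ x # vs), int (length xs))
    = (q1, tape Blank (xs @ y # vs), int (length xs) - 1)"
    using snoc.prems by (simp add: gstep_def trans_def xy)
  moreover have "dir q1 = 0" using dir_tr[of q x] xy snoc.prems(1) by simp
  ultimately show ?case using snoc.IH[of q1 ys' "y # vs"] snoc.prems(2) ys'
    by (simp add: funpow_Suc_right del: funpow.simps)
qed (simp add: rl_def)

lemma sweep_right_turn:
  assumes "dir q = 2" "Blank \<notin> set xs" "lr q xs = (q', ys)"
  shows "(stp ^^ (length xs + 1)) (q, tape Blank xs, 0)
    = (turn q', tape Blank ys, int (length xs) - 1)"
proof -
  have "dir q' = 2" using dir_lr[of q xs] assms by simp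
  moreover have "length ys = length xs" using length_lr[of q xs] assms by simp
  moreover have "q' \<notin> {Acc, Rej}" using \<open>dir q' = 2\<close> by auto
  ultimately have "stp (q', tape Blank ys, int (length xs)) = (turn q', tape Blank ys, int
      (length xs) - 1)"
    by (simp add: gstep_def trans_def flip: \<open>length ys = length xs\<close>)
  then show ?thesis using sweep_right[OF assms, of "[]"] by simp
qed

lemma sweep_left_turn:
  assumes "dir q = 0" "Blank \<notin> set xs" "rl q xs = (q', ys)"
  shows "(stp ^^ (length xs + 1)) (q, tape Blank xs, int (length xs) - 1)
    = (turn q', tape Blank ys, 0)"
proof -
  have "dir q' = 0" using dir_lr[of q "rev xs"] assms by
      (auto simp: rl_def Let_def split: prod.splits)
  moreover have "q' \<notin> {Acc, Rej}" using \<open>dir q' = 0\<close> by auto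
  ultimately have "stp (q', tape Blank ys, - 1) = (turn q', tape Blank ys, 0)"
    by (simp add: gstep_def trans_def)
  then show ?thesis using sweep_left[OF assms, of "[]"] by simp
qed

section \<open>Sweeps over an encoded instance\<close>

fun bval :: "bool list \<Rightarrow> nat" where
  "bval [] = 0"
| "bval (b # bs) = of_bool b + 2 * bval bs"

text \<open>Subtraction of the borrow \<open>w\<close>. The length is kept, so counting down never
  changes the tape layout.\<close>

fun bdec :: "bool \<Rightarrow> bool list \<Rightarrow> bool list" where
  "bdec w [] = []"
| "bdec w (b # bs) = (b \<noteq> w) # bdec (w \<and> \<not> b) bs"

declare bin.simps [simp del]

lemma bval_bin: "bval (bin n) = n"
  by (induction n rule: bin.induct) (subst bin.simps, auto)

lemma bval_pos: "0 < bval bs \<longleftrightarrow> True \<in> set bs"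
  by (induction bs) auto

lemma bdec_False [simp]: "bdec False bs = bs"
  by (induction bs) auto

lemma bval_bdec: "True \<in> set bs \<Longrightarrow> bval (bdec True bs) = bval bs - 1"
  by (induction bs) (auto simp: bval_pos[symmetric])

lemma length_bdec [simp]: "length (bdec w bs) = length bs"
  by (induction w bs rule: bdec.induct) auto

section \<open>Layout of the labelled tape\<close>

definition cells :: "sec \<Rightarrow> (nat \<Rightarrow> bool) \<Rightarrow> nat \<Rightarrow> nat set \<Rightarrow> nat set \<Rightarrow> nat \<Rightarrow> sym list" where
  "cells s e c X Y n = map (\<lambda>j. Cell s (e j) (j \<in> X) (j \<in> Y) (j = c)) [0..<n]"

definition row :: "sec \<Rightarrow> (nat \<Rightarrow> bool) \<Rightarrow> bool \<Rightarrow> nat \<Rightarrow> nat set \<Rightarrow> nat set \<Rightarrow> nat \<Rightarrow> sym list" where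
  "row s e k c X Y d = cells s e c X Y d @ [Sep s k]"

definition num :: "sec \<Rightarrow> bool list \<Rightarrow> sym list" where
  "num s bs = map (\<lambda>b. Cell s b False False False) bs @ [Sep s False]"

definition mat :: "(nat \<times> nat) set \<Rightarrow> nat \<Rightarrow> nat set \<Rightarrow> nat set \<Rightarrow> nat \<Rightarrow> nat \<Rightarrow> sym list" where
  "mat E c X Y d n = concat (map (\<lambda>i. row SM (\<lambda>j. (i, j) \<in> E) (i = c) c X Y d) [0..<n])"

lemma cells_Suc: "cells s e c X Y (Suc n) = cells s e c X Y n @ [Cell s (e n) (n \<in> X) (n \<in> Y) (n
    = c)]"
  by (simp add: cells_def)

lemma mat_Suc: "mat E c X Y d (Suc n) = mat E c X Y d n @ row SM (\<lambda>j. (n, j) \<in> E) (n = c) c X Y d"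
  by (simp add: mat_def)

lemma mat_0 [simp]: "mat E c X Y d 0 = []" by (simp add: mat_def)

lemma length_row [simp]: "length (row s e k c X Y d) = Suc d"
  by (simp add: row_def cells_def)

lemma length_num [simp]: "length (num s bs) = Suc (length bs)"
  by (simp add: num_def)

lemma length_mat [simp]: "length (mat E c X Y d n) = n * Suc d"
  by (induction n) (simp_all add: mat_Suc)

lemma Blank_row [simp]: "Blank \<notin> set (row s e k c X Y d)"
  by (auto simp: row_def cells_def)

lemma Blank_num [simp]: "Blank \<notin> set (num s bs)"
  by (auto simp: num_def)

lemma Blank_mat [simp]: "Blank \<notin> set (mat E c X Y d n)"
  by (induction n) (simp_all add: mat_Suc)

text \<open>The pointer column \<open>c\<close> runs cyclically through \<open>0, \<dots>, d\<close>; at \<open>c = d\<close> it is invisible.\<close>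
definition cnext :: "nat \<Rightarrow> nat \<Rightarrow> nat" where
  "cnext d c = (if c = d then 0 else Suc c)"

section \<open>Update sweeps\<close>

lemma lr_Upd_cells:
  assumes "n \<le> d" "c \<le> d" "s \<in> {SM, ST, SP}"
  shows "lr (Upd m (c = d) b (c = d) cm bv br) (cells s e c X Y n)
    = (Upd m (c = d) b (if n = 0 then c = d else n = Suc c) cm bv br,
       cells s e (cnext d c) (if c = d then Y else X) (if b then insert c Y else Y) n)"
  using assms(1)
proof (induction n)
  case (Suc n)
  \<comment> \<open>The carry is the pointer bit of cell \<open>n - 1\<close>, hence
    \<open>n = Suc c\<close>; before the first cell it is set exactly when the pointer wraps from
    \<open>d\<close> to 0.\<close>
  have "lr (Upd m (c = d) b (if n = 0 then c = d else n = Suc c) cm bv br)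
      [Cell s (e n) (n \<in> X) (n \<in> Y) (n = c)]
    = (Upd m (c = d) b (n = c) cm bv br,
       [Cell s (e n) (n \<in> (if c = d then Y else X)) (n \<in> (if b then insert c Y else Y)) (n
           = cnext d c)])"
    using assms Suc.prems by (auto simp: cnext_def)
  then show ?case
    using lr_append[OF Suc.IH] Suc.prems unfolding cells_Suc by auto
qed (simp add: cells_def)

lemma lr_Upd_row:
  assumes "c \<le> d" "s \<in> {SM, ST, SP}"
  shows "lr (Upd m (c = d) b (c = d) cm bv br) (row s e k c X Y d)
    = (Upd m (c = d) b (c = d) k bv br,
       row s e (s = SM \<and> cm) (cnext d c) (if c = d then Y else X) (if b then insert c Y else Y) d)"
  unfolding row_def by (rule lr_append[OF lr_Upd_cells]) (use assms in auto)

text \<open>The row mark is delayed from separator to separator just as the pointer is from cell to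
  cell, so row and column advance together.\<close>

lemma lr_Upd_mat:
  assumes "n \<le> d" "c \<le> d"
  shows "lr (upd m (c = d) b bv br) (mat E c X Y d n)
    = (Upd m (c = d) b (c = d) (if n = 0 then c = d else n = Suc c) bv br,
       mat E (cnext d c) (if c = d then Y else X) (if b then insert c Y else Y) d n)"
  using assms(1)
proof (induction n)
  case (Suc n)
  have "(n = cnext d c) = (if n = 0 then c = d else n = Suc c)"
    using Suc.prems assms(2) by (auto simp: cnext_def)
  then show ?case
    using lr_append[OF Suc.IH lr_Upd_row] Suc.prems assms(2) unfolding mat_Suc by auto
qed simp

lemma lr_Upd_num_V:
  "\<exists>bv'. lr (Upd m w b cp False bv br) (num SV bs) = (Upd m w b w False bv' br, num SV
      (bdec bv bs))"
proof (induction bs arbitrary: cp bv)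
  case (Cons x xs)
  then obtain bv' where "lr (Upd m w b False False (bv \<and> \<not> x) br) (num SV xs)
    = (Upd m w b w False bv' br, num SV (bdec (bv \<and> \<not> x) xs))" by blast
  then show ?case by (simp add: num_def)
qed (simp add: num_def)

lemma lr_Upd_num_R:
  "\<exists>br'. lr (Upd m w b cp False bv br) (num SR bs) = (Upd m w b w False bv br', num SR
      (bdec br bs))"
proof (induction bs arbitrary: cp br)
  case (Cons x xs)
  then obtain br' where "lr (Upd m w b False False bv (br \<and> \<not> x)) (num SR xs)
    = (Upd m w b w False bv br', num SR (bdec (br \<and> \<not> x) xs))" by blast
  then show ?case by (simp add: num_def)
qed (simp add: num_def)

lemma lr_Upd_num_K:
  "lr (Upd m w b cp False bv br) (num SK bs) = (Upd m w b w False bv br, num SK bs)"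
proof (induction bs arbitrary: cp)
  case (Cons x xs)
  from Cons[of False] show ?case by (simp add: num_def)
qed (simp add: num_def)

section \<open>Scan sweeps\<close>

lemma lr_Scan:
  assumes "\<forall>x\<in>set xs. \<exists>s e u y p. x = Cell s e u y p"
  shows "lr (Scan m cur A) xs = (Scan m cur (A \<union> \<Union> (emit cur ` set xs)), xs)"
  using assms by (induction xs arbitrary: A) (auto simp del: emit.simps)

lemma rl_Scan:
  assumes "\<forall>x\<in>set xs. \<exists>s e u y p. x = Cell s e u y p"
  shows "rl (Scan m cur A) xs = (Scan m cur (A \<union> \<Union> (emit cur ` set xs)), xs)"
  using lr_Scan[of "rev xs"] assms by (simp add: rl_def)

lemma rl_Scan_Sep:
  "rl (Scan m cur A) [Sep s k] = (Scan m k (A \<union> emit cur (Sep s k)), [Sep s k])"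
  by (simp add: rl_def)

lemma rl_Scan_row:
  "rl (Scan m cur A) (row s e k c X Y d) = (Scan m k (A \<union> emit cur (Sep s k) \<union>
     (\<Union>j<d. emit k (Cell s (e j) (j \<in> X) (j \<in> Y) (j = c)))), row s e k c X Y d)"
proof -
  have "emit k ` set (cells s e c X Y d) = (\<lambda>j. emit k (Cell s (e j) (j \<in> X) (j \<in> Y) (j
      = c))) ` {..<d}"
    by (simp add: cells_def image_image atLeast0LessThan del: emit.simps)
  then show ?thesis
    using rl_append[OF rl_Scan_Sep rl_Scan, of "cells s e c X Y d"]
    unfolding row_def by (auto simp: cells_def simp del: emit.simps)
qed

lemma rl_Scan_num:
  "rl (Scan m cur A) (num s bs) = (Scan m False (A \<union>
     (\<Union>b\<in>set bs. emit False (Cell s b False False False))), num s bs)"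
  using rl_append[OF rl_Scan_Sep rl_Scan, of "map
      (\<lambda>b. Cell s b False False False) bs" m cur A s False]
  unfolding num_def by (auto simp: image_image)

lemma rl_Scan_mat:
  "\<exists>cur'. rl (Scan m cur A) (mat E c X Y d n) = (Scan m cur' (A \<union>
     (\<Union>i<n. emit False (Sep SM (i = c)) \<union>
       (\<Union>j<d. emit (i = c) (Cell SM ((i, j) \<in> E) (j \<in> X) (j \<in> Y) (j = c))))), mat E c X Y d n)"
proof (induction n arbitrary: cur A)
  case 0
  then show ?case by (simp add: rl_def)
next
  case (Suc n)
  from Suc[of "n = c"] obtain cur' where
    "rl (Scan m (n = c) (A \<union> emit cur (Sep SM (n = c)) \<union>
        (\<Union>j<d. emit (n = c) (Cell SM ((n, j) \<in> E) (j \<in> X) (j \<in> Y) (j = c))))) (mat E c X Y d n)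
     = (Scan m cur' (A \<union> emit cur (Sep SM (n = c)) \<union>
        (\<Union>j<d. emit (n = c) (Cell SM ((n, j) \<in> E) (j \<in> X) (j \<in> Y) (j = c))) \<union>
     (\<Union>i<n. emit False (Sep SM (i = c)) \<union>
       (\<Union>j<d. emit (i = c) (Cell SM ((i, j) \<in> E) (j \<in> X) (j \<in> Y) (j = c))))), mat E c X Y d n)"
    by blast
  from rl_append[OF rl_Scan_row this]
  show ?case by (auto simp only: mat_Suc lessThan_Suc UN_insert Un_assoc emit.simps(2))
qed

section \<open>The computation\<close>

locale ovpp =
  fixes d :: nat and E :: "(nat \<times> nat) set" and T P :: "nat set" and bk :: "bool list"
  assumes E_sub: "E \<subseteq> {..<d} \<times> {..<d}" and T_sub: "T \<subseteq> {..<d}"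
begin

definition lay :: "nat \<Rightarrow> nat set \<Rightarrow> nat set \<Rightarrow> bool list \<Rightarrow> bool list \<Rightarrow> sym list" where
  "lay c X Y bv br = mat E c X Y d d @ row ST (\<lambda>j. j \<in> T) False c X Y d @
     row SP (\<lambda>j. j \<in> P) False c X Y d @ num SV bv @ num SR br @ num SK bk"

text \<open>Neither the pointer nor the sets affect the length, so every sweep over the layout takes
  \<open>len bv br + 1\<close> steps.\<close>

definition len :: "bool list \<Rightarrow> bool list \<Rightarrow> nat" where
  "len bv br = 2 * length (lay 0 {} {} bv br)"

lemma length_lay: "length (fills (lay c X Y bv br)) = len bv br"
  by (simp add: lay_def len_def)

lemma len_cong: "length bv = length bv' \<Longrightarrow> length br = length br' \<Longrightarrow> len bv br = len bv' br'"
  by (simp add: lay_def len_def)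

lemma Blank_lay: "Blank \<notin> set (fills (lay c X Y bv br))"
  by (auto simp: lay_def)

lemma lr_Upd_lay:
  assumes "c \<le> d"
  shows "\<exists>q. turn q = Scan m False {} \<and> lr (upd m (c = d) b dv dr) (lay c X Y bv br) =
    (q, lay (cnext d c) (if c = d then Y else X) (if b then insert c Y else Y) (bdec dv bv)
        (bdec dr br))"
proof -
  let ?X = "if c = d then Y else X" and ?Y = "if b then insert c Y else Y"
  let ?U = "\<lambda>cm bv br. Upd m (c = d) b (c = d) cm bv br"
  have M: "lr (?U (c = d) dv dr) (mat E c X Y d d) = (?U (if d = 0 then c = d else d
      = Suc c) dv dr, mat E (cnext d c) ?X ?Y d d)"
    using lr_Upd_mat[of d d c] assms by simp
  \<comment> \<open>Any incoming mark \<open>cm\<close> from the last matrix row is allowed: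
    separators outside the matrix do not store it.\<close>
  have T: "lr (?U cm dv dr) (row ST (\<lambda>j. j \<in> T) False c X Y d) = (?U False dv dr, row ST
      (\<lambda>j. j \<in> T) False (cnext d c) ?X ?Y d)" for cm
    using lr_Upd_row[of c d ST] assms by simp
  have P: "lr (?U cm dv dr) (row SP (\<lambda>j. j \<in> P) False c X Y d) = (?U False dv dr, row SP
      (\<lambda>j. j \<in> P) False (cnext d c) ?X ?Y d)" for cm
    using lr_Upd_row[of c d SP] assms by simp
  obtain dv' where V: "lr (?U False dv dr) (num SV bv) = (?U False dv' dr, num SV (bdec dv bv))"
    using lr_Upd_num_V by blast
  obtain dr' where R: "lr (?U False dv' dr) (num SR br) = (?U False dv' dr', num SR (bdec dr br))"
    using lr_Upd_num_R by blast
  have K: "lr (?U False dv' dr') (num SK bk) = (?U False dv' dr', num SK bk)"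
    by (rule lr_Upd_num_K)
  show ?thesis unfolding lay_def
    using lr_append[OF M lr_append[OF T lr_append[OF P lr_append[OF V lr_append[OF R K]]]]]
    by (intro exI conjI) auto
qed

text \<open>Links flags to sets. \<open>Any\<close> and \<open>attr_flags\<close> speak about the
  vertex \<open>c\<close>, hence the guard \<open>c < d\<close>.\<close>

definition scan_info :: "nat \<Rightarrow> nat set \<Rightarrow> nat set \<Rightarrow> bool list \<Rightarrow> bool list \<Rightarrow> flag set \<Rightarrow> bool" where
  "scan_info c X Y bv br A \<longleftrightarrow>
    (On \<in> A \<longleftrightarrow> c < d) \<and> (Ch \<in> A \<longleftrightarrow> X \<inter> {..<d} \<noteq> Y \<inter> {..<d}) \<and>
    (Vnz \<in> A \<longleftrightarrow> 0 < bval bv) \<and> (Rnz \<in> A \<longleftrightarrow> 0 < bval br) \<and>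
    (c < d \<longrightarrow> (Any \<in> A \<longleftrightarrow> c \<in> pre E X) \<and> (attr_flags A \<longleftrightarrow> c \<in> attr E P T X))"

lemma rl_Scan_lay:
  assumes "c \<le> d"
  shows "\<exists>cur A. rl (Scan m False {}) (lay c X Y bv br) = (Scan m cur A, lay c X Y bv br) \<and>
    scan_info c X Y bv br A"
proof -
  define AK where "AK = (\<Union>b\<in>set bk. emit False (Cell SK b False False False))"
  define AR where "AR = AK \<union> (\<Union>b\<in>set br. emit False (Cell SR b False False False))"
  define AV where "AV = AR \<union> (\<Union>b\<in>set bv. emit False (Cell SV b False False False))"
  define AP where "AP = AV \<union> emit False (Sep SP False) \<union>
     (\<Union>j<d. emit False (Cell SP (j \<in> P) (j \<in> X) (j \<in> Y) (j = c)))"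
  define AT where "AT = AP \<union> emit False (Sep ST False) \<union>
     (\<Union>j<d. emit False (Cell ST (j \<in> T) (j \<in> X) (j \<in> Y) (j = c)))"
  define A where "A = AT \<union> (\<Union>i<d. emit False (Sep SM (i = c)) \<union>
       (\<Union>j<d. emit (i = c) (Cell SM ((i, j) \<in> E) (j \<in> X) (j \<in> Y) (j = c))))"
  obtain cur where "rl (Scan m False AT) (mat E c X Y d d) = (Scan m cur A, mat E c X Y d d)"
    using rl_Scan_mat[of m False AT E c X Y d d] unfolding A_def by blast
  then have "rl (Scan m False {}) (lay c X Y bv br) = (Scan m cur A, lay c X Y bv br)"
    unfolding lay_def AT_def AP_def AV_def AR_def AK_def
    using rl_append[OF rl_append[OF rl_append[OF rl_append[OF rl_append[OF
      rl_Scan_num[of m False "{}" SK bk] rl_Scan_num[of _ _ _ SR br]] rl_Scan_num[of _ _ _ SV bv]]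
      rl_Scan_row[of _ _ _ SP "\<lambda>j. j \<in> P" False c X Y d]] rl_Scan_row[of _ _ _ ST
          "\<lambda>j. j \<in> T" False c X Y d]]]
    by simp
  moreover have "On \<in> A \<longleftrightarrow> c < d"
    by (auto simp: A_def AT_def AP_def AV_def AR_def AK_def)
  moreover have "Ch \<in> A \<longleftrightarrow> X \<inter> {..<d} \<noteq> Y \<inter> {..<d}"
  proof -
    have "Ch \<in> A \<longleftrightarrow> (\<exists>j<d. (j \<in> X) \<noteq> (j \<in> Y))"
      by (auto simp: A_def AT_def AP_def AV_def AR_def AK_def)
    then show ?thesis by auto
  qed
  moreover have "Vnz \<in> A \<longleftrightarrow> True \<in> set bv" "Rnz \<in> A \<longleftrightarrow> True \<in> set br"
    by (auto simp: A_def AT_def AP_def AV_def AR_def AK_def)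
  \<comment> \<open>Edges end below \<open>d\<close>, so quantifying over the columns is quantifying
    over all successors.\<close>
  moreover have ex: "(\<exists>j<d. (c, j) \<in> E \<and> j \<in> X) \<longleftrightarrow> (\<exists>w\<in>X. (c, w) \<in> E)"
    "(\<exists>j<d. (c, j) \<in> E \<and> j \<notin> X) \<longleftrightarrow> \<not> (\<forall>w. (c, w) \<in> E \<longrightarrow> w \<in> X)"
    using E_sub by blast+
  moreover have
    any: "c < d \<Longrightarrow> Any \<in> A \<longleftrightarrow> (\<exists>j<d. (c, j) \<in> E \<and> j \<in> X)" and
    nall: "c < d \<Longrightarrow> Nall \<in> A \<longleftrightarrow> (\<exists>j<d. (c, j) \<in> E \<and> j \<notin> X)" and
    tf: "c < d \<Longrightarrow> Tf \<in> A \<longleftrightarrow> c \<in> T" and pf: "c < d \<Longrightarrow> Pf \<in> A \<longleftrightarrow> c \<in> P"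
    by (auto simp: A_def AT_def AP_def AV_def AR_def AK_def)
  moreover have "c < d \<Longrightarrow> Any \<in> A \<longleftrightarrow> c \<in> pre E X"
    using any by (simp add: ex pre_def)
  moreover have "c < d \<Longrightarrow> attr_flags A \<longleftrightarrow> c \<in> attr E P T X"
    unfolding attr_flags_def attr_def by (simp add: any nall tf pf ex)
  ultimately show ?thesis
    unfolding scan_info_def bval_pos
    by (intro exI[of _ cur] exI[of _ A]) simp
qed

section \<open>Rounds, phases and their duration\<close>

definition cfg :: "mode \<Rightarrow> nat \<Rightarrow> nat set \<Rightarrow> nat set \<Rightarrow> bool list \<Rightarrow> bool list \<Rightarrow> state \<times>
    (int \<Rightarrow> sym) \<times> int" where
  "cfg m c X Y bv br = (Scan m False {}, tape Blank (fills (lay c X Y bv br)), int (len bv br) - 1)"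

lemma run_update:
  assumes "c \<le> d"
  shows "(stp ^^ (len bv br + 1)) (upd m (c = d) b dv dr, tape Blank (fills (lay c X Y bv br)), 0)
    = cfg m (cnext d c) (if c = d then Y else X) (if b then insert c Y else Y) (bdec dv bv)
        (bdec dr br)"
proof -
  obtain q where q: "turn q = Scan m False {}" "lr (upd m (c = d) b dv dr) (lay c X Y bv br) =
    (q, lay (cnext d c) (if c = d then Y else X) (if b then insert c Y else Y) (bdec dv bv)
        (bdec dr br))"
    using lr_Upd_lay[OF assms] by blast
  have L: "len (bdec dv bv) (bdec dr br) = len bv br" by (intro len_cong) simp_all
  show ?thesis unfolding cfg_def L
    by (rule sweep_right_turn[OF dir.simps(2) Blank_lay lr_fills[OF q(2)], unfolded length_lay
        q(1)])
qed

lemma run_scan: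
  assumes "c \<le> d"
  shows "\<exists>A. (stp ^^ (len bv br + 1)) (cfg m c X Y bv br)
      = (decide m A, tape Blank (fills (lay c X Y bv br)), 0) \<and>
    scan_info c X Y bv br A"
proof -
  obtain cur A where A: "rl (Scan m False {}) (lay c X Y bv br) = (Scan m cur A, lay c X Y bv br)"
    "scan_info c X Y bv br A"
    using rl_Scan_lay[OF assms] by blast
  show ?thesis
    using sweep_left_turn[OF dir.simps(4) Blank_lay rl_fills[OF A(1)], unfolded length_lay
        turn.simps] A(2)
    unfolding cfg_def by blast
qed

text \<open>Time for one pointer position: a scan and an update. A full round takes
  \<open>Suc d\<close> of these.\<close>

definition round_len :: "bool list \<Rightarrow> bool list \<Rightarrow> nat" where
  "round_len bv br = 2 * len bv br + 2"

lemma run_trans: "(f ^^ a) x = y \<Longrightarrow> (f ^^ (b + a)) x = (f ^^ b) y"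
  by (simp add: funpow_add)

lemma run_step:
  assumes "(stp ^^ (len bv br + 1)) C = C'" "(stp ^^ (len bv br + 1)) C' = C''"
  shows "(stp ^^ round_len bv br) C = C''"
proof -
  have eq: "round_len bv br = (len bv br + 1) + (len bv br + 1)" by (simp add: round_len_def)
  show ?thesis unfolding eq run_trans[OF assms(1)] by (rule assms(2))
qed

definition winner_step :: "mode \<Rightarrow> nat set \<Rightarrow> nat set" where
  "winner_step m X = (if m = Grab then pre E X else attr E P T X)"

lemma step_column:
  assumes "c < d" "m = Final \<Longrightarrow> 0 < bval bv"
  shows "(stp ^^ round_len bv br) (cfg m c X Y bv br)
    = cfg m (Suc c) X (if c \<in> winner_step m X then insert c Y else Y) (bdec (m = Final) bv) br"
proof -
  obtain A where A: "(stp ^^ (len bv br + 1)) (cfg m c X Y bv br)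
      = (decide m A, tape Blank (fills (lay c X Y bv br)), 0)"
    "scan_info c X Y bv br A"
    using run_scan[of c bv br m X Y] assms(1) by auto
  have "decide m A = upd m (c = d) (c \<in> winner_step m X) (m = Final) False"
    using A(2) assms by (simp add: scan_info_def decide_def winner_step_def)
  from run_step[OF A(1)[unfolded this] run_update] show ?thesis
    using assms(1) by (simp add: cnext_def)
qed

lemma step_halt:
  assumes "c < d" "bval bv = 0"
  shows "fst ((stp ^^ (len bv br + 1)) (cfg Final c X Y bv br))
    = (if c \<in> attr E P T X then Acc else Rej)"
proof -
  obtain A where A: "(stp ^^ (len bv br + 1)) (cfg Final c X Y bv br)
      = (decide Final A, tape Blank (fills (lay c X Y bv br)), 0)" "scan_info c X Y bv br A"
    using run_scan[of c bv br Final X Y] assms(1) by auto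
  have "decide Final A = (if c \<in> attr E P T X then Acc else Rej)"
    using A(2) assms by (simp add: scan_info_def decide_def)
  then show ?thesis unfolding A(1) by simp
qed

lemma step_wrap:
  assumes "m \<noteq> Final" "X \<subseteq> {..<d}" "Y \<subseteq> {..<d}"
  shows "(stp ^^ round_len bv br) (cfg m d X Y bv br)
    = (if X \<noteq> Y then cfg Attr 0 Y Y bv br
       else if m = Attr \<and> 0 < bval br then cfg Grab 0 Y Y bv (bdec True br)
       else cfg Final 0 Y Y bv br)"
proof -
  obtain A where A: "(stp ^^ (len bv br + 1)) (cfg m d X Y bv br)
      = (decide m A, tape Blank (fills (lay d X Y bv br)), 0)"
    "scan_info d X Y bv br A"
    using run_scan[of d bv br m X Y] by auto
  note up = run_update[of d bv br _ False False _ X Y, unfolded simp_thms]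
  have "decide m A = (if X \<noteq> Y then upd Attr True False False False
      else if m = Attr \<and> 0 < bval br then upd Grab True False False True
      else upd Final True False False False)"
    using A(2) assms by (simp add: scan_info_def decide_def Int_absorb2) 
  then show ?thesis
    using run_step[OF A(1), of "cfg _ _ _ _ _ _"] up by (auto simp: cnext_def)
qed

lemma winner_step_sub: "winner_step m X \<subseteq> {..<d}"
  using E_sub T_sub by (auto simp: winner_step_def attr_def pre_def)

text \<open>\<open>X\<close> stays fixed during a round while \<open>Y\<close> collects, so the
  round computes one simultaneous step of the operator.\<close>

lemma run_columns:
  assumes "m \<noteq> Final" "n \<le> d"
  shows "(stp ^^ (n * round_len bv br)) (cfg m 0 X X bv br)
    = cfg m n X (X \<union> winner_step m X \<inter> {..<n}) bv br"
  using assms(2)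
proof (induction n)
  case (Suc n)
  have eq: "Suc n * round_len bv br = round_len bv br + n * round_len bv br" by simp
  have "(if n \<in> winner_step m X then insert n (X \<union> winner_step m X \<inter> {..<n}) else X
      \<union> winner_step m X \<inter> {..<n})
      = X \<union> winner_step m X \<inter> {..<Suc n}"
    by (auto simp: lessThan_Suc)
  then show ?case unfolding eq funpow_add
    using Suc step_column[of n m bv br X "X \<union> winner_step m X \<inter> {..<n}"] assms(1) by simp
qed simp

lemma run_round:
  assumes "m \<noteq> Final" "X \<subseteq> {..<d}"
  shows "(stp ^^ (Suc d * round_len bv br)) (cfg m 0 X X bv br)
    = (if winner_step m X \<subseteq> X then if m = Attr \<and> 0 < bval br then cfg Grab 0 X X bv (bdec True br)
         else cfg Final 0 X X bv br
       else cfg Attr 0 (X \<union> winner_step m X) (X \<union> winner_step m X) bv br)"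
proof -
  have eq: "Suc d * round_len bv br = round_len bv br + d * round_len bv br" by simp
  have Y: "X \<union> winner_step m X \<inter> {..<d} = X \<union> winner_step m X" using winner_step_sub by blast
  show ?thesis unfolding eq run_trans[OF run_columns[OF assms(1) order_refl]] Y
  proof (cases "winner_step m X \<subseteq> X")
    case True
    then have "X \<union> winner_step m X = X" by blast
    then show "(stp ^^ round_len bv br) (cfg m d X (X \<union> winner_step m X) bv br)
      = (if winner_step m X \<subseteq> X then if m = Attr \<and> 0 < bval br then cfg Grab 0 X X bv (bdec True br)
           else cfg Final 0 X X bv br
         else cfg Attr 0 (X \<union> winner_step m X) (X \<union> winner_step m X) bv br)"
      using step_wrap[OF assms assms(2)] True by simp
  next
    case False
    then have "X \<noteq> X \<union> winner_step m X" by blast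
    then show "(stp ^^ round_len bv br) (cfg m d X (X \<union> winner_step m X) bv br)
      = (if winner_step m X \<subseteq> X then if m = Attr \<and> 0 < bval br then cfg Grab 0 X X bv (bdec True br)
           else cfg Final 0 X X bv br
         else cfg Attr 0 (X \<union> winner_step m X) (X \<union> winner_step m X) bv br)"
      using step_wrap[OF assms, of "X \<union> winner_step m X"] winner_step_sub assms(2) False by simp
  qed
qed

text \<open>Induction on the number of vertices outside \<open>X\<close>. Of an attractor round and
  the grab round after it, one enlarges \<open>X\<close> or the search ends; this gives two rounds
  per missing vertex and two to finish. \<open>T\<close> is joined to the base because it enters
  \<open>X\<close> only with the first attractor round.\<close>

lemma run_phases:
  assumes "X \<subseteq> {..<d}"
  shows "\<exists>t \<le> (2 * card ({..<d} - X) + 2) * (Suc d * round_len bv br). \<exists>br'. length br' = length br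
      \<and>
    (stp ^^ t) (cfg Attr 0 X X bv br)
      = cfg Final 0 {v. grab_win E P (X \<union> T) (bval br) v} {v. grab_win E P (X \<union> T)
          (bval br) v} bv br'"
  using assms
proof (induction "card ({..<d} - X)" arbitrary: X br rule: less_induct)
  case less
  let ?R = "Suc d * round_len bv br"
  have smaller: "card ({..<d} - (X \<union> winner_step m X)) < card ({..<d} - X)" if
      "\<not> winner_step m X \<subseteq> X" for m
    using that winner_step_sub[of m X] by (intro psubset_card_mono) auto
  have Fd: "X \<union> winner_step m X \<subseteq> {..<d}" for m using less.prems winner_step_sub by blast
  note r1 = run_round[of Attr X bv br, OF _ less.prems, simplified]
  show ?case
  proof (cases "winner_step Attr X \<subseteq> X")
    case False
    let ?X = "X \<union> winner_step Attr X"
    obtain t br' where t: "t \<le> (2 * card ({..<d} - ?X) + 2) * ?R" "length br' = length br"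
      "(stp ^^ t) (cfg Attr 0 ?X ?X bv br)
      = cfg Final 0 {v. grab_win E P (?X \<union> T) (bval br) v} {v. grab_win E P (?X \<union> T)
          (bval br) v} bv br'"
      using less.hyps[OF smaller[OF False] Fd] by blast
    have "grab_win E P (?X \<union> T) (bval br) v = grab_win E P (X \<union> T) (bval br) v" for v
    proof (rule grab_win_base_cong)
      show "grab_win E P (X \<union> T) 0 u" if "u \<in> ?X \<union> T" for u
        using that by (auto simp: winner_step_def attr_def intro: grab_win.intros)
    qed auto
    then have "(stp ^^ (t + ?R)) (cfg Attr 0 X X bv br)
      = cfg Final 0 {v. grab_win E P (X \<union> T) (bval br) v} {v. grab_win E P (X \<union> T)
          (bval br) v} bv br'"
      using r1 False t(3) by (simp add: funpow_add)
    moreover have "t + ?R \<le> (2 * card ({..<d} - X) + 2) * ?R"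
    proof -
      \<comment> \<open>The extra round is paid for by the strict decrease of the cardinality, which
        frees two rounds.\<close>
      have "t + ?R \<le> (2 * card ({..<d} - ?X) + 3) * ?R" using t(1) by (simp add: algebra_simps)
      also have "\<dots> \<le> (2 * card ({..<d} - X) + 2) * ?R"
        using smaller[OF False] by (intro mult_right_mono) auto
      finally show ?thesis .
    qed
    ultimately show ?thesis using t(2) by blast
  next
    case True
    have XT: "X \<union> T = X" using True by (auto simp: winner_step_def attr_def)
    have cl: "attr E P X X \<subseteq> X" using True by (auto simp: winner_step_def attr_def)
    show ?thesis
    proof (cases "bval br = 0")
      case 0: True
      have "{v. grab_win E P X 0 v} = X" using grab_win_closed_0[OF cl] by
          (auto intro: grab_win.base)
      then have "(stp ^^ ?R) (cfg Attr 0 X X bv br)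
        = cfg Final 0 {v. grab_win E P (X \<union> T) (bval br) v} {v. grab_win E P (X \<union> T)
            (bval br) v} bv br"
        using r1 True XT 0 by simp
      then show ?thesis by (intro exI[of _ ?R]) auto
    next
      case pos: False
      let ?br = "bdec True br"
      have bval: "bval br = Suc (bval ?br)" using pos bval_bdec[of br] bval_pos[of br] by auto
      have R: "round_len bv ?br = round_len bv br"
        unfolding round_len_def by (simp add: len_cong[of bv bv ?br br])
      have r2: "(stp ^^ (?R + ?R)) (cfg Attr 0 X X bv br)
        = (if winner_step Grab X \<subseteq> X then cfg Final 0 X X bv ?br
           else cfg Attr 0 (X \<union> winner_step Grab X) (X \<union> winner_step Grab X) bv ?br)"
        using r1 True pos run_round[of Grab X bv ?br, OF _ less.prems] by (simp add: funpow_add R)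
      show ?thesis
      proof (cases "winner_step Grab X \<subseteq> X")
        case stable: True
        then have "{v. grab_win E P X (bval br) v} = X"
          using grab_win_closed_pre[OF cl] by (auto simp: winner_step_def)
        then have "(stp ^^ (?R + ?R)) (cfg Attr 0 X X bv br)
          = cfg Final 0 {v. grab_win E P (X \<union> T) (bval br) v} {v. grab_win E P (X \<union> T)
              (bval br) v} bv ?br"
          using r2 stable XT by simp
        then show ?thesis by (intro exI[of _ "?R + ?R"] conjI exI[of _ ?br])
            (simp_all add: algebra_simps)
      next
        case False
        let ?X = "X \<union> winner_step Grab X"
        obtain t br' where t: "t \<le> (2 * card ({..<d} - ?X) + 2) * ?R" "length br' = length br"
          "(stp ^^ t) (cfg Attr 0 ?X ?X bv ?br)
          = cfg Final 0 {v. grab_win E P (?X \<union> T) (bval ?br) v} {v. grab_win E P (?X \<union> T)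
              (bval ?br) v} bv br'"
          using less.hyps[OF smaller[OF False] Fd, of ?br] unfolding R by auto
        have "grab_win E P (?X \<union> T) (bval ?br) v = grab_win E P (X \<union> T) (bval br) v" for v
        proof -
          \<comment> \<open>The grab round trades one unit of \<open>br\<close> for a predecessor
            step in the base.\<close>
          have "?X \<union> T = X \<union> pre E X" using XT by (auto simp: winner_step_def)
          then show ?thesis using grab_win_closed_Suc[OF cl] XT bval by simp
        qed
        then have "(stp ^^ (t + (?R + ?R))) (cfg Attr 0 X X bv br)
          = cfg Final 0 {v. grab_win E P (X \<union> T) (bval br) v} {v. grab_win E P (X \<union> T)
              (bval br) v} bv br'"
          using r2 False t(3) by (simp add: funpow_add)
        moreover have "t + (?R + ?R) \<le> (2 * card ({..<d} - X) + 2) * ?R"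
        proof -
          have "t + (?R + ?R) \<le> (2 * card ({..<d} - ?X) + 4) * ?R" using t(1) by
              (simp add: algebra_simps)
          also have "\<dots> \<le> (2 * card ({..<d} - X) + 2) * ?R"
            using smaller[OF False] by (intro mult_right_mono) auto
          finally show ?thesis .
        qed
        ultimately show ?thesis using t(2) by blast
      qed
    qed
  qed
qed

text \<open>\<open>c + bval bv\<close> is invariant, so the pointer stands on the sought vertex when
  the counter reaches 0.\<close>

lemma run_final:
  assumes "c + bval bv < d"
  shows "fst ((stp ^^ (bval bv * round_len bv br + (len bv br + 1))) (cfg Final c X Y bv br))
    = (if c + bval bv \<in> attr E P T X then Acc else Rej)"
  using assms
proof (induction "bval bv" arbitrary: c Y bv)
  case 0
  then show ?case using step_halt[of c bv br X Y] by simp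
next
  case (Suc n)
  let ?bv = "bdec True bv"
  have n: "bval ?bv = n" using Suc(2) bval_bdec[of bv] bval_pos[of bv] by simp
  have L: "len ?bv br = len bv br" by (simp add: len_cong[of ?bv bv br br])
  have R: "round_len ?bv br = round_len bv br" by (simp add: round_len_def L)
  \<comment> \<open>Only \<open>Y\<close> may change here; the verdict is read off
    \<open>X\<close>.\<close>
  obtain Y' where "(stp ^^ round_len bv br) (cfg Final c X Y bv br) = cfg Final (Suc c) X Y' ?bv br"
    using step_column[of c Final bv br X Y] Suc.hyps(2) Suc.prems by auto
  moreover have "bval bv * round_len bv br + (len bv br + 1)
    = (n * round_len bv br + (len bv br + 1)) + round_len bv br"
    using Suc.hyps(2)[symmetric] by simp
  ultimately have "(stp ^^ (bval bv * round_len bv br + (len bv br + 1))) (cfg Final c X Y bv br)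
    = (stp ^^ (n * round_len bv br + (len bv br + 1))) (cfg Final (Suc c) X Y' ?bv br)"
    using run_trans by metis
  then show ?case
    using Suc.hyps(1)[of ?bv "Suc c" Y'] Suc.hyps(2)[symmetric] Suc.prems n
    by (simp add: L R del: funpow.simps)
qed


section \<open>Decoding the input\<close>

text \<open>Starting and ending in \<open>Dec None\<close> makes decodings of consecutive words
  composable.\<close>

definition decodes :: "bool list \<Rightarrow> sym list \<Rightarrow> bool" where
  "decodes w xs \<longleftrightarrow> lr (Dec None) (map Bit w) = (Dec None, fills xs)"

lemma decodes_append: "decodes w xs \<Longrightarrow> decodes u ys \<Longrightarrow> decodes (w @ u) (xs @ ys)"
  unfolding decodes_def by (simp add: lr_append)

definition raw :: "bool list \<Rightarrow> sym list" where
  "raw bs = map Raw bs @ [RawSep]"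

lemma decodes_word: "decodes (enc_bits bs @ sep) (raw bs)"
  by (induction bs) (auto simp: decodes_def raw_def enc_bits_def sep_def)

lemma rl_Lab_word: "rl (Lab s) (raw bs) = (Lab (prv s), num (prv s) bs)"
proof -
  have cells: "lr (Lab t) (map Raw cs) = (Lab t, map (\<lambda>b. Cell t b False False False) cs)" for t cs
    by (induction cs) auto
  then have "rl (Lab t) (map Raw bs) = (Lab t, map (\<lambda>b. Cell t b False False False) bs)" for t
    by (simp add: rl_def rev_map)
  moreover have "rl (Lab s) [RawSep] = (Lab (prv s), [Sep (prv s) False])" by (simp add: rl_def)
  ultimately show ?thesis unfolding raw_def num_def by (intro rl_append)
qed

definition raw_mat :: "nat \<Rightarrow> sym list" where
  "raw_mat n = concat (map (\<lambda>i. raw (map (\<lambda>j. (i, j) \<in> E) [0..<d])) [0..<n])"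

lemma decodes_mat: "decodes (enc_matrix d E) (raw_mat d)"
proof -
  have "decodes (concat (map (\<lambda>i. enc_bits (map (\<lambda>j. (i, j) \<in> E) [0..<d]) @ sep) [0..<n]))
      (raw_mat n)" for n
  proof (induction n)
    case 0
    then show ?case by (simp add: decodes_def raw_mat_def)
  next
    case (Suc n)
    from decodes_append[OF this decodes_word] show ?case by (simp add: raw_mat_def)
  qed
  then show ?thesis by (simp add: enc_matrix_def)
qed

text \<open>With pointer \<open>d\<close> and empty sets all marks are off, so a row looks like a
  labelled word and one labelling lemma covers all sections.\<close>

lemma row_start: "row s e False d {} {} d = num s (map e [0..<d])"
  by (simp add: row_def cells_def num_def)

lemma rl_Lab_mat:
  assumes "prv s = SM" "n \<le> d"
  shows "\<exists>s'. rl (Lab s) (raw_mat n) = (Lab s', mat E d {} {} d n)"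
  using assms
proof (induction n arbitrary: s)
  case 0
  then show ?case by (simp add: raw_mat_def rl_def)
next
  case (Suc n)
  obtain s' where "rl (Lab (prv s)) (raw_mat n) = (Lab s', mat E d {} {} d n)"
    using Suc.IH[of "prv s"] Suc.prems by auto
  from rl_append[OF rl_Lab_word this] show ?case
    using Suc.prems by (auto simp: mat_Suc row_start raw_mat_def)
qed

definition input :: "bool list \<Rightarrow> bool list \<Rightarrow> bool list" where
  "input bv br = enc_matrix d E @ enc_set d T @ enc_set d P @ (enc_bits bv @ sep)
    @ (enc_bits br @ sep) @ (enc_bits bk @ sep)"

text \<open>Three sweeps: decoding, labelling, and an update that wraps the pointer from
  \<open>d\<close> to 0.\<close>

lemma run_prelude:
  "length (input bv br) = len bv br"
  "(stp ^^ (3 * (len bv br + 1))) (Dec None, tape Blank (map Bit (input bv br)), 0)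
      = cfg Attr 0 {} {} bv br"
proof -
  define xs where "xs = raw_mat d @ raw (map (\<lambda>j. j \<in> T) [0..<d]) @ raw (map (\<lambda>j. j \<in> P) [0..<d])
    @ raw bv @ raw br @ raw bk"
  have dec: "lr (Dec None) (map Bit (input bv br)) = (Dec None, fills xs)"
    unfolding decodes_def[symmetric] input_def xs_def enc_set_def
    by (intro decodes_append decodes_mat decodes_word)
  obtain s' where mat: "rl (Lab ST) (raw_mat d) = (Lab s', mat E d {} {} d d)"
    using rl_Lab_mat[of ST d] by auto
  note word = rl_Lab_word
  have "rl (Lab S0) xs = (Lab s', lay d {} {} bv br)"
    unfolding xs_def lay_def row_start
    using rl_append[OF rl_append[OF rl_append[OF rl_append[OF rl_append[OF word[of S0 bk] word]
        word] word] word], of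
        "raw_mat d" "Lab s'" "mat E d {} {} d d" "map (\<lambda>j. j \<in> T) [0..<d]" "map
            (\<lambda>j. j \<in> P) [0..<d]" bv br] mat
    by simp
  then have lab: "rl (Lab S0) (fills xs) = (Lab s', fills (lay d {} {} bv br))" by (rule rl_fills)
  have "length (fills xs) = length (input bv br)"
    using length_lr[of "Dec None" "map Bit (input bv br)"] unfolding dec by simp
  moreover have "length (fills (lay d {} {} bv br)) = length (fills xs)"
    using length_rl[of "Lab S0" "fills xs"] unfolding lab by simp
  ultimately have len: "length (map Bit (input bv br)) = len bv br" "length (fills xs) = len bv br"
    by (simp_all only: length_lay length_map)
  then show "length (input bv br) = len bv br" by simp
  let ?n = "len bv br + 1"
  have xs_Blank: "Blank \<notin> set (fills xs)"
    by (auto simp: xs_def raw_mat_def raw_def)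
  have "(stp ^^ ?n) (Dec None, tape Blank (map Bit (input bv br)), 0)
    = (Lab S0, tape Blank (fills xs), int (len bv br) - 1)"
    using sweep_right_turn[OF dir.simps(1) _ dec] unfolding len turn.simps by auto
  moreover have "(stp ^^ ?n) (Lab S0, tape Blank (fills xs), int (len bv br) - 1)
    = (upd Attr (d = d) False False False, tape Blank (fills (lay d {} {} bv br)), 0)"
    using sweep_left_turn[OF dir.simps(3) xs_Blank lab] unfolding len turn.simps by simp
  moreover have "(stp ^^ ?n) (upd Attr (d = d) False False False, tape Blank (fills
      (lay d {} {} bv br)), 0)
    = cfg Attr 0 {} {} bv br"
    unfolding run_update[OF order_refl] by (simp add: cnext_def)
  moreover have "3 * ?n = ?n + (?n + ?n)" by simp
  ultimately show "(stp ^^ (3 * ?n)) (Dec None, tape Blank (map Bit (input bv br)), 0)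
      = cfg Attr 0 {} {} bv br"
    using run_trans by metis
qed

lemma run_input:
  assumes "bval bv < d"
  shows "\<exists>t \<le> 100 * length (input bv br) ^ 3 + 100.
    fst ((stp ^^ t) (Dec None, tape Blank (map Bit (input bv br)), 0))
      = (if bval bv \<in> attr E P T {u. grab_win E P T (bval br) u} then Acc else Rej)"
proof -
  let ?Z = "{u. grab_win E P T (bval br) u}"
  obtain t br' where t: "t \<le> (2 * card ({..<d} - {}) + 2) * (Suc d * round_len bv br)"
    and br': "length br' = length br" and run: "(stp ^^ t) (cfg Attr 0 {} {} bv br)
        = cfg Final 0 ?Z ?Z bv br'"
    using run_phases[of "{}" bv br] by auto
  have L: "len bv br' = len bv br" using br' by (simp add: len_cong[of bv bv br' br])
  then have R: "round_len bv br' = round_len bv br" by (simp add: round_len_def)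
  let ?f = "bval bv * round_len bv br + (len bv br + 1)"
  let ?t = "?f + (t + 3 * (len bv br + 1))"
  have "fst ((stp ^^ ?t) (Dec None, tape Blank (map Bit (input bv br)), 0))
      = (if bval bv \<in> attr E P T ?Z then Acc else Rej)"
    unfolding run_trans[OF trans[OF run_trans[OF run_prelude(2)] run]]
    using run_final[of 0 bv br' ?Z ?Z] assms unfolding L R by simp
  moreover have "?t \<le> 100 * length (input bv br) ^ 3 + 100"
  proof -
    define N where "N = len bv br"
    have "d \<le> N" by (simp add: N_def len_def lay_def)
    have "1 \<le> N" by (simp add: N_def len_def lay_def)
    have R: "round_len bv br = 2 * (N + 1)" by (simp add: round_len_def N_def)
    have "t \<le> (2 * (N + 1)) * ((N + 1) * (2 * (N + 1)))"
      using t unfolding R by (rule order_trans) (intro mult_mono; use \<open>d \<le> N\<close> in simp)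
    moreover have "bval bv * round_len bv br \<le> (N + 1) * (2 * (N + 1))"
      unfolding R by (intro mult_right_mono) (use assms \<open>d \<le> N\<close> in auto)
    ultimately have "?t \<le> 4 * (N + 1) ^ 3 + 2 * (N + 1) ^ 2 + 4 * (N + 1)"
      unfolding N_def[symmetric] by (simp add: power3_eq_cube power2_eq_square algebra_simps)
    \<comment> \<open>From \<open>1 \<le> N\<close> follows \<open>N + 1 \<le> 2 * N\<close>; the
      total is then at most \<open>48 * N ^ 3\<close>.\<close>
    also have "\<dots> \<le> 4 * (2 * N) ^ 3 + 2 * (2 * N) ^ 2 + 4 * (2 * N)"
      using \<open>1 \<le> N\<close> by (intro add_mono mult_left_mono power_mono) auto
    also have "\<dots> \<le> 100 * N ^ 3"
    proof -
      have "N ^ 2 \<le> N ^ 3" "N ^ 1 \<le> N ^ 3" using \<open>1 \<le> N\<close> by (intro power_increasing; simp)+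
      then show ?thesis by (simp add: power_mult_distrib)
    qed
    finally show ?thesis by (simp add: run_prelude(1) N_def)
  qed
  ultimately show ?thesis by blast
qed

end

section \<open>The polynomial-time decision procedure\<close>

theorem theorem31:
  "\<exists>M c e. wf_tm M \<and>
     (\<forall>G k cf. wf_game G \<and> valid_conf G k cf \<longrightarrow>
        (\<exists>t \<le> c * length (enc_instance k G cf) ^ e + c.
           fst ((tm_step M ^^ t) (tm_init (enc_instance k G cf)))
             = (if P1_wins G k cf then 1 else 2)))"
proof -
  have "snd (snd (trans q a)) \<le> 2" for q a by (cases q) (auto simp: trans_def)
  then obtain M where M: "wf_tm M" and sim: "\<And>w t q. fst ((stp ^^ t)
      (Dec None, tape Blank (map (\<lambda>x. if x then Bit True else Bit False) w), 0)) = q \<Longrightarrow>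
    (q = Acc \<longrightarrow> fst ((tm_step M ^^ t) (tm_init w)) = 1) \<and>
    (q = Rej \<longrightarrow> fst ((tm_step M ^^ t) (tm_init w)) = 2)"
    using ex_tm[of "Dec None" Acc Rej Blank "Bit False" "Bit True" trans] unfolding Let_def by auto
  have bits: "map (\<lambda>x. if x then Bit True else Bit False) w = map Bit w" for w by auto
  have "\<exists>t \<le> 100 * length (enc_instance k G cf) ^ 3 + 100.
      fst ((tm_step M ^^ t) (tm_init (enc_instance k G cf))) = (if P1_wins G k cf then 1 else 2)"
    if wf: "wf_game G" and valid: "valid_conf G k cf" for G k cf
  proof -
    obtain v P r where cf: "cf = (v, P, r)" by (metis prod.exhaust)
    interpret ovpp "gd G" "gE G" "gT G" P "bin k"
      by unfold_locales (use wf in \<open>auto simp: wf_game_def\<close>)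
    have v: "bval (bin v) < gd G" using valid by (simp add: bval_bin valid_conf_def cf)
    have inp: "enc_instance k G cf = input (bin v) (bin r)"
      by (simp add: enc_instance_def input_def cf enc_nat_def)
    obtain t where t: "t \<le> 100 * length (enc_instance k G cf) ^ 3 + 100"
      "fst ((stp ^^ t) (Dec None, tape Blank (map Bit (enc_instance k G cf)), 0))
        = (if P1_wins G k cf then Acc else Rej)"
      using run_input[OF v, of "bin r"] unfolding bval_bin inp[symmetric] cf P1_wins_iff[OF wf]
      by blast
    then show ?thesis using sim[of t "enc_instance k G cf", unfolded bits, OF t(2)]
      by (intro exI[of _ t]) (auto split: if_splits)
  qed
  then show ?thesis using M by blast
qed

end
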